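(* Let $M_R,M_T\ge1$ be integers, $\sigma>0$, and $\rho_1,\rho_2$ real with $|\rho_1|<1$, $|\rho_2|<1$. Let $\mathbf H=(h_{ij})$, $1\le i\le M_R$, $1\le j\le M_T$, be a random channel matrix with Rayleigh fading entries, $\mathbb{E}|h_{ij}|^2=\sigma^2$, following the Kronecker product correlation model: $\mathbf H=\mathbf R_R^{1/2}\mathbf H_w\mathbf R_T^{1/2}$, where $\mathbf H_w$ has independent identically distributed entries, $\mathbf R_R$ is the $M_R\times M_R$ matrix with ones on the diagonal and $\rho_1^2$ off the diagonal, $\mathbf R_T$ is the $M_T\times M_T$ matrix with ones on the diagonal and $\rho_2^2$ off the diagonal, and the overall spatial correlation matrix is $\mathbf R=\mathbf R_T^{\mathrm T}\otimes\mathbf R_R$; in this model the coefficients are parameterized, for $2\le i\le M_R$ and $2\le j\le M_T$, as $$h_{11}=z_0,\quad h_{i1}=\sqrt{1-\rho_1^2}\,z_{i1}+\rho_1z_0,\quad h_{1j}=\sqrt{1-\rho_2^2}\,z_{1j}+\rho_2z_0,\quad h_{ij}=\sqrt{1-\rho_1^2\rho_2^2}\,z_{ij}+\rho_1\rho_2z_0,$$ where $z_0,z_{i1},z_{1j},z_{ij}$ are independent complex Gaussian variables with mean $0$ and variance $\sigma^2$. Let $|h_{\rm FAS}|=\max_{i,j}|h_{ij}|$. Then for a threshold $\gamma_{th}>0$, the outage probability $P_{\rm out}(\gamma_{th})$, i.e. the probability of the event $\{|h_{\rm FAS}|^2<\gamma_{th}\}$, is $$\begin{aligned}P_{\rm 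out}(\gamma_{th})=\int_0^{\gamma_{th}}e^{-t}&\prod_{i=2}^{M_R}\left(1-Q_1\!\left(\sqrt{\tfrac{2\rho_1^2t}{1-\rho_1^2}},\sqrt{\tfrac{2\gamma_{th}}{1-\rho_1^2}}\right)\right)\prod_{j=2}^{M_T}\left(1-Q_1\!\left(\sqrt{\tfrac{2\rho_2^2t}{1-\rho_2^2}},\sqrt{\tfrac{2\gamma_{th}}{1-\rho_2^2}}\right)\right)\\&\times\prod_{i=2}^{M_R}\prod_{j=2}^{M_T}\left(1-Q_1\!\left(\sqrt{\tfrac{2\rho_2^2\rho_1^2t}{1-\rho_1^2\rho_2^2}},\sqrt{\tfrac{2\gamma_{th}}{1-\rho_1^2\rho_2^2}}\right)\right)dt.\end{aligned}$$
   Context: $h_{ij}$ is the complex channel coefficient from the $j$-th transmit port to the $i$-th receive port of a system with a fluid antenna at each end, which always selects the port pair with the largest gain; Rayleigh fading means each $h_{ij}$ is circularly symmetric complex Gaussian with mean $0$. The outage event is that the normalized received signal-to-noise ratio, identified with $|h_{\rm FAS}|^2$, falls below $\gamma_{th}$. $Q_1(a,b)=\int_b^\infty x\,e^{-\frac{x^2+a^2}{2}}I_0(ax)\,dx$ ($a,b\ge0$) is the first-order Marcum $Q$-function, with $I_0$ the modified Bessel function of the first kind of order $0$. Empty products equal $1$.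
   Formalization: The outage event is taken as |h_FAS|²/σ² < γ_th, since the formula fails for |h_FAS|² < γ_th unless σ = 1; the Kronecker matrix description, inconsistent with the stated parameterization of the h_ij, is dropped and only the parameterization is assumed. *)

theory Defs
  imports "HOL-Probability.Probability"
begin

text \<open>
  Circularly symmetric complex Gaussian with mean 0 and variance \<open>v = E |Z|\<^sup>2\<close>: the real and
  imaginary parts are independent, each with mean 0 and variance \<open>v / 2\<close>. The second argument of
  \<^const>\<open>normal_density\<close> is the standard deviation.
\<close>

definition complex_gaussian :: "'a measure \<Rightarrow> ('a \<Rightarrow> complex) \<Rightarrow> real \<Rightarrow> bool" where
  "complex_gaussian M Z v \<longleftrightarrow>
     Z \<in> borel_measurable M \<and>
     distributed M lborel (\<lambda>\<omega>. Re (Z \<omega>)) (normal_density 0 (sqrt (v / 2))) \<and>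
     distributed M lborel (\<lambda>\<omega>. Im (Z \<omega>)) (normal_density 0 (sqrt (v / 2))) \<and>
     prob_space.indep_var M borel (\<lambda>\<omega>. Re (Z \<omega>)) borel (\<lambda>\<omega>. Im (Z \<omega>))"

definition bessel_I0 :: "real \<Rightarrow> real" where
  "bessel_I0 x = (\<Sum>k. (x / 2) ^ (2 * k) / (fact k)\<^sup>2)"

definition marcum_Q1 :: "real \<Rightarrow> real \<Rightarrow> real" where
  "marcum_Q1 a b = (LBINT x:{b..}. x * exp (- (x\<^sup>2 + a\<^sup>2) / 2) * bessel_I0 (a * x))"

text \<open>The modulus of the selected channel, for indices \<open>1 \<le> i \<le> m\<close> and \<open>1 \<le> j \<le> n\<close>.\<close>

definition fas_abs :: "nat \<Rightarrow> nat \<Rightarrow> (nat \<Rightarrow> nat \<Rightarrow> 'a \<Rightarrow> complex) \<Rightarrow> 'a \<Rightarrow> real" where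
  "fas_abs m n h \<omega> = Max ((\<lambda>(i, j). cmod (h i j \<omega>)) ` ({1..m} \<times> {1..n}))"

end

theory Submission
  imports Defs "HOL-Real_Asymp.Real_Asymp"
begin

text \<open>
  Given \<open>z\<^sub>0\<close>, the remaining coefficients are independent, so the outage probability is the
  expectation over \<open>|z\<^sub>0|\<^sup>2 / \<sigma>\<^sup>2 = t\<close> of a product of disc probabilities for shifted complex
  Gaussians. The law of \<open>|Z / \<sigma> + w|\<^sup>2\<close> is found without polar coordinates: the square of a real
  Gaussian with mean \<open>a\<close> and variance \<open>1/2\<close> is a mixture of Gamma laws of shape \<open>j + 1/2\<close> with
  Poisson weights of mean \<open>a\<^sup>2\<close>. Both families are closed under convolution (Beta integral,
  binomial theorem), so the sum of the two squares is the Poisson mixture with mean \<open>|w|\<^sup>2\<close> of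
  Gamma laws of shape \<open>k + 1\<close>, whose density is \<open>exp (- u - |w|\<^sup>2) * I\<^sub>0 (2 |w| sqrt u)\<close>. The
  substitution \<open>u = x\<^sup>2 / 2\<close> turns its tail into \<open>Q\<^sub>1\<close>, and \<open>w = 0\<close> gives the exponential law of \<open>t\<close>.
\<close>

section \<open>Substitution by squares\<close>

text \<open>Monotone convergence, used to carry a substitution from compact intervals to a
  half-line. The endpoints \<open>b\<close> are left general because the two sides of the
  substitution exhaust the half-line at different speeds, \<open>n\<^sup>2\<close> and
  \<open>n\<close>.\<close>

lemma nn_integral_atLeast_eq_SUP:
  fixes f :: "real \<Rightarrow> ennreal" and b :: "nat \<Rightarrow> real"
  assumes [measurable]: "f \<in> borel_measurable borel"
    and "mono b" and "filterlim b at_top sequentially"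
  shows "(\<integral>\<^sup>+x. f x * indicator {a..} x \<partial>lborel) = (SUP n. \<integral>\<^sup>+x. f x * indicator {a..b n} x \<partial>lborel)"
proof -
  have "f x * indicator {a..} x = (SUP n. f x * indicator {a..b n} x)" for x
  proof -
    obtain n where n: "x \<le> b n"
      using assms(3) by (metis eventually_sequentially filterlim_at_top order_refl)
    have "(SUP n. f x * indicator {a..b n} x) \<ge> f x * indicator {a..} x"
      using n by (intro SUP_upper2[of n]) (auto simp: indicator_def)
    moreover have "(SUP n. f x * indicator {a..b n} x) \<le> f x * indicator {a..} x"
      by (intro SUP_least) (auto simp: indicator_def)
    ultimately show ?thesis by (rule antisym)
  qed
  then have "(\<integral>\<^sup>+x. f x * indicator {a..} x \<partial>lborel) = (\<integral>\<^sup>+x. (SUP n. f x * indicator {a..b n} x) \<partial>lborel)"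
    by simp
  also have "\<dots> = (SUP n. \<integral>\<^sup>+x. f x * indicator {a..b n} x \<partial>lborel)"
  proof (rule nn_integral_monotone_convergence_SUP)
    show "incseq (\<lambda>n x. f x * indicator {a..b n} x)"
    proof (intro monoI le_funI mult_left_mono)
      fix m n :: nat and x assume "m \<le> n"
      then have "b m \<le> b n" using assms(2) by (rule monoD[rotated])
      then show "indicator {a..b m} x \<le> (indicator {a..b n} x :: ennreal)"
        by (auto simp: indicator_def)
    qed auto
  qed auto
  finally show ?thesis .
qed

text \<open>On a compact interval this is the change of variables u = x^2 with derivative 2x >= 0;
  both sides then increase to their half-line integrals. \<open>Suc n\<close> keeps every interval
  nondegenerate.\<close>

lemma nn_integral_substitution_square:
  fixes f :: "real \<Rightarrow> ennreal"
  assumes [measurable]: "f \<in> borel_measurable borel"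
  shows "(\<integral>\<^sup>+u. f u * indicator {0..} u \<partial>lborel) = (\<integral>\<^sup>+x. ennreal (2 * x) * f (x\<^sup>2) * indicator {0..} x \<partial>lborel)"
proof -
  have "(\<integral>\<^sup>+u. f u * indicator {0..(real (Suc n))\<^sup>2} u \<partial>lborel) =
      (\<integral>\<^sup>+x. ennreal (2 * x) * f (x\<^sup>2) * indicator {0..real (Suc n)} x \<partial>lborel)" for n
  proof -
    have "(\<integral>\<^sup>+u. f u * indicator {0\<^sup>2..(real (Suc n))\<^sup>2} u \<partial>lborel) =
      (\<integral>\<^sup>+x. f (x\<^sup>2) * ennreal (2 * x) * indicator {0..real (Suc n)} x \<partial>lborel)"
      by (intro nn_integral_substitution_aux) (auto intro!: derivative_eq_intros continuous_intros)
    then show ?thesis by (simp add: mult_ac)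
  qed
  moreover have "mono (\<lambda>n. (real (Suc n))\<^sup>2)" "mono (\<lambda>n. real (Suc n))"
    by (auto intro!: monoI power_mono)
  moreover have "filterlim (\<lambda>n. (real (Suc n))\<^sup>2) at_top sequentially"
      "filterlim (\<lambda>n. real (Suc n)) at_top sequentially"
    by real_asymp+
  ultimately show ?thesis
    using nn_integral_atLeast_eq_SUP[of f "\<lambda>n. (real (Suc n))\<^sup>2" 0]
      nn_integral_atLeast_eq_SUP[of "\<lambda>x. ennreal (2 * x) * f (x\<^sup>2)" "\<lambda>n. real (Suc n)" 0]
    by simp
qed

text \<open>Since g(x^2) is even, reflecting the negative half-line moves all the mass of
  \<open>f\<close> to x >= 0, where squaring is injective.\<close>

lemma nn_integral_even_reflect:
  fixes f :: "real \<Rightarrow> ennreal" and g :: "real \<Rightarrow> ennreal"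
  assumes [measurable]: "f \<in> borel_measurable borel" "g \<in> borel_measurable borel"
  shows "(\<integral>\<^sup>+x. f x * g (x\<^sup>2) \<partial>lborel) = (\<integral>\<^sup>+x. (f x + f (- x)) * g (x\<^sup>2) * indicator {0..} x \<partial>lborel)"
proof -
  have "(\<integral>\<^sup>+x. f x * g (x\<^sup>2) \<partial>lborel) =
      (\<integral>\<^sup>+x. f x * g (x\<^sup>2) * indicator {0..} x + f x * g (x\<^sup>2) * indicator {..<0} x \<partial>lborel)"
    by (intro nn_integral_cong) (auto simp: indicator_def)
  also have "\<dots> = (\<integral>\<^sup>+x. f x * g (x\<^sup>2) * indicator {0..} x \<partial>lborel) + (\<integral>\<^sup>+x. f x * g (x\<^sup>2) * indicator {..<0} x \<partial>lborel)"
    by (rule nn_integral_add) auto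
  also have "(\<integral>\<^sup>+x. f x * g (x\<^sup>2) * indicator {..<0} x \<partial>lborel) =
      (\<integral>\<^sup>+x. f (- x) * g (x\<^sup>2) * indicator {..<0} (- x) \<partial>lborel)"
    using nn_integral_real_affine[of "\<lambda>x. f x * g (x\<^sup>2) * indicator {..<0} x" "-1" 0] by simp
  \<comment> \<open>Reflection turns the open half-line into x > 0; it differs from
    \<open>{0..}\<close> only in the null set {0}.\<close>
  also have "\<dots> = (\<integral>\<^sup>+x. f (- x) * g (x\<^sup>2) * indicator {0..} x \<partial>lborel)"
    by (intro nn_integral_cong_AE) (use AE_lborel_singleton[of 0] in eventually_elim, auto simp: indicator_def)
  also have "(\<integral>\<^sup>+x. f x * g (x\<^sup>2) * indicator {0..} x \<partial>lborel) + \<dots> =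
      (\<integral>\<^sup>+x. f x * g (x\<^sup>2) * indicator {0..} x + f (- x) * g (x\<^sup>2) * indicator {0..} x \<partial>lborel)"
    by (rule nn_integral_add[symmetric]) auto
  finally show ?thesis by (simp add: distrib_right)
qed

section \<open>Gamma densities and Poisson mixtures\<close>

text \<open>The Gamma density of shape \<open>a\<close> and rate 1. Its value 0 for u <= 0 lets
  convolutions be written as integrals over the whole line.\<close>

definition gamma_pdf :: "real \<Rightarrow> real \<Rightarrow> real" where
  "gamma_pdf a u = (if 0 < u then u powr (a - 1) * exp (- u) / Gamma a else 0)"

lemma gamma_pdf_measurable [measurable]: "gamma_pdf a \<in> borel_measurable borel"
  unfolding gamma_pdf_def by measurable

lemma gamma_pdf_nonneg: "0 < a \<Longrightarrow> 0 \<le> gamma_pdf a u"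
  by (auto simp: gamma_pdf_def Gamma_real_pos less_imp_le)

text \<open>The scaling u = w s separates the dependence on w from a Beta integral over [0, 1], and
  Beta(a, b) = Gamma(a) Gamma(b) / Gamma(a + b) supplies the right constant.\<close>

lemma nn_integral_gamma_pdf_convolution_kernel:
  assumes "0 < a" "0 < b"
  shows "(\<integral>\<^sup>+u. ennreal (gamma_pdf a u * gamma_pdf b (w - u)) \<partial>lborel) = ennreal (gamma_pdf (a + b) w)"
proof (cases "0 < w")
  case False
  then have "gamma_pdf a u * gamma_pdf b (w - u) = 0" for u by (auto simp: gamma_pdf_def)
  then have "(\<integral>\<^sup>+u. ennreal (gamma_pdf a u * gamma_pdf b (w - u)) \<partial>lborel) = 0"
    by (simp only: ennreal_0 nn_integral_const) simp
  with False show ?thesis by (simp add: gamma_pdf_def)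
next
  case True
  \<comment> \<open>Everything independent of s: the exponent is (a - 1) + (b - 1), and the Jacobian
    \<open>w\<close> raises it to a + b - 1 at the end.\<close>
  define C where "C = w powr (a + b - 2) * exp (- w) / (Gamma a * Gamma b)"
  have C: "0 \<le> C" using assms by (auto simp: C_def intro!: divide_nonneg_nonneg mult_nonneg_nonneg Gamma_real_nonneg)
  let ?k = "\<lambda>s. s powr (a - 1) * (1 - s) powr (b - 1)"
  \<comment> \<open>Outside [0, 1] one of the two densities has a negative argument and vanishes;
    the endpoints are left to a null set.\<close>
  have k: "gamma_pdf a (w * s) * gamma_pdf b (w - w * s) = C * (?k s * indicator {0..1} s)"
    if "s \<noteq> 0" "s \<noteq> 1" for s
  proof (cases "0 < s \<and> s < 1")
    case s: True
    have "w - w * s = w * (1 - s)" by (simp add: algebra_simps)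
    moreover have "w powr (a + b - 2) = w powr (a - 1) * w powr (b - 1)"
      by (subst powr_add[symmetric]) (simp add: algebra_simps)
    moreover have "exp (- w) = exp (- (w * s)) * exp (- (w * (1 - s)))"
      by (subst exp_add[symmetric]) (simp add: algebra_simps)
    moreover have "0 < w * (1 - s)" "0 < w * s" using s True by auto
    ultimately show ?thesis using s True
      by (simp add: gamma_pdf_def C_def powr_mult)
  next
    case False
    then consider "s < 0" | "1 < s" using \<open>s \<noteq> 0\<close> \<open>s \<noteq> 1\<close> by linarith
    then show ?thesis
    proof cases
      case 1
      then have "w * s \<le> 0" using True by (simp add: mult_le_0_iff)
      then show ?thesis using 1 by (simp add: gamma_pdf_def)
    next
      case 2
      then have "w - w * s \<le> 0" using True by simp
      then show ?thesis using 2 by (simp add: gamma_pdf_def)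
    qed
  qed
  have "(\<integral>\<^sup>+u. ennreal (gamma_pdf a u * gamma_pdf b (w - u)) \<partial>lborel)
      = ennreal w * (\<integral>\<^sup>+s. ennreal (gamma_pdf a (w * s) * gamma_pdf b (w - w * s)) \<partial>lborel)"
    using True by (subst nn_integral_real_affine[where c = w and t = 0]) auto
  also have "(\<integral>\<^sup>+s. ennreal (gamma_pdf a (w * s) * gamma_pdf b (w - w * s)) \<partial>lborel)
      = (\<integral>\<^sup>+s. ennreal C * ennreal (?k s * indicator {0..1} s) \<partial>lborel)"
  proof (intro nn_integral_cong_AE)
    show "AE s in lborel. ennreal (gamma_pdf a (w * s) * gamma_pdf b (w - w * s)) =
        ennreal C * ennreal (?k s * indicator {0..1} s)"
      using AE_lborel_singleton[of 0] AE_lborel_singleton[of 1]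
      by eventually_elim (simp add: k C flip: ennreal_mult)
  qed
  also have "\<dots> = ennreal C * (\<integral>\<^sup>+s. ennreal (?k s * indicator {0..1} s) \<partial>lborel)"
    by (rule nn_integral_cmult) auto
  also have "(\<integral>\<^sup>+s. ennreal (?k s * indicator {0..1} s) \<partial>lborel) = ennreal (Beta a b)"
  proof -
    have "(\<integral>\<^sup>+s. ennreal (?k s * indicator {0..1} s) \<partial>lborel) = (\<integral>\<^sup>+s. ennreal (?k s) * indicator {0..1} s \<partial>lborel)"
      by (intro nn_integral_cong) (auto simp: indicator_def)
    also have "\<dots> = ennreal (Beta a b)"
      by (rule nn_integral_has_integral_lebesgue'[OF _ has_integral_Beta_real[OF assms]]) simp
    finally show ?thesis .
  qed
  also have "ennreal w * (ennreal C * ennreal (Beta a b)) = ennreal (w * (C * Beta a b))"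
    using C True assms by (simp add: ennreal_mult' Beta_def Gamma_real_nonneg flip: ennreal_mult)
  also have "w * (C * Beta a b) = gamma_pdf (a + b) w"
  proof -
    have "w * w powr (a + b - 2) = w powr (a + b - 1)"
      using True by (simp add: powr_mult_base)
    moreover have "Gamma a \<noteq> 0" "Gamma b \<noteq> 0" using assms by (simp_all add: Gamma_real_pos less_imp_neq[symmetric])
    ultimately show ?thesis using True by (simp add: C_def Beta_def gamma_pdf_def field_simps)
  qed
  finally show ?thesis .
qed

text \<open>Substitute w = u + v in the inner integral and exchange the order by Tonelli; the
  integral over u is then the kernel just computed.\<close>

lemma nn_integral_gamma_pdf_convolution:
  fixes g :: "real \<Rightarrow> ennreal"
  assumes "0 < a" "0 < b" and [measurable]: "g \<in> borel_measurable borel"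
  shows "(\<integral>\<^sup>+u. ennreal (gamma_pdf a u) * (\<integral>\<^sup>+v. ennreal (gamma_pdf b v) * g (u + v) \<partial>lborel) \<partial>lborel)
    = (\<integral>\<^sup>+w. ennreal (gamma_pdf (a + b) w) * g w \<partial>lborel)"
proof -
  have "(\<integral>\<^sup>+v. ennreal (gamma_pdf b v) * g (u + v) \<partial>lborel) = (\<integral>\<^sup>+w. ennreal (gamma_pdf b (w - u)) * g w \<partial>lborel)" for u
    by (subst nn_integral_real_affine[where c = 1 and t = "-u"]) auto
  then have "(\<integral>\<^sup>+u. ennreal (gamma_pdf a u) * (\<integral>\<^sup>+v. ennreal (gamma_pdf b v) * g (u + v) \<partial>lborel) \<partial>lborel)
      = (\<integral>\<^sup>+u. ennreal (gamma_pdf a u) * (\<integral>\<^sup>+w. ennreal (gamma_pdf b (w - u)) * g w \<partial>lborel) \<partial>lborel)"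
    by simp
  also have "\<dots> = (\<integral>\<^sup>+u. (\<integral>\<^sup>+w. ennreal (gamma_pdf a u) * (ennreal (gamma_pdf b (w - u)) * g w) \<partial>lborel) \<partial>lborel)"
    by (intro nn_integral_cong nn_integral_cmult[symmetric]) auto
  also have "\<dots> = (\<integral>\<^sup>+w. (\<integral>\<^sup>+u. ennreal (gamma_pdf a u) * (ennreal (gamma_pdf b (w - u)) * g w) \<partial>lborel) \<partial>lborel)"
    by (rule lborel_pair.Fubini') auto
  also have "\<dots> = (\<integral>\<^sup>+w. (\<integral>\<^sup>+u. ennreal (gamma_pdf a u * gamma_pdf b (w - u)) * g w \<partial>lborel) \<partial>lborel)"
    using assms by (simp add: ennreal_mult' gamma_pdf_nonneg mult.assoc)
  also have "\<dots> = (\<integral>\<^sup>+w. (\<integral>\<^sup>+u. ennreal (gamma_pdf a u * gamma_pdf b (w - u)) \<partial>lborel) * g w \<partial>lborel)"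
    by (intro nn_integral_cong nn_integral_multc) auto
  also have "\<dots> = (\<integral>\<^sup>+w. ennreal (gamma_pdf (a + b) w) * g w \<partial>lborel)"
    using assms by (simp add: nn_integral_gamma_pdf_convolution_kernel)
  finally show ?thesis .
qed

text \<open>This explicit value makes Gamma densities of half-integer shape produce the coefficients
  1 / (2j)! of the cosh series.\<close>

lemma Gamma_half_plus_nat: "Gamma (real j + 1 / 2) = fact (2 * j) * sqrt pi / (4 ^ j * fact j)"
proof (induction j)
  case 0 then show ?case by (simp add: Gamma_one_half_real)
next
  case (Suc j)
  have "real j + 1 / 2 \<notin> \<int>\<^sub>\<le>\<^sub>0"
    by (auto elim!: nonpos_Ints_cases)
  then have "Gamma (real (Suc j) + 1 / 2) = (real j + 1 / 2) * Gamma (real j + 1 / 2)"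
    using Gamma_plus1[of "real j + 1 / 2"] by (simp add: add_ac)
  also have "\<dots> = (real j + 1 / 2) * (fact (2 * j) * sqrt pi / (4 ^ j * fact j))"
    by (simp only: Suc.IH)
  also have "\<dots> = fact (2 * Suc j) * sqrt pi / (4 ^ Suc j * fact (Suc j))"
  proof -
    have "(fact (2 * Suc j) :: real) = 4 * (real j + 1) * ((real j + 1 / 2) * fact (2 * j))"
      by (simp add: algebra_simps)
    moreover have "(fact (Suc j) :: real) = (real j + 1) * fact j"
      by simp
    moreover have "real j + 1 \<noteq> 0" by linarith
    ultimately show ?thesis by (simp only: power_Suc) (simp add: divide_simps)
  qed
  finally show ?case .
qed

text \<open>The Poisson probability of \<open>k\<close> with mean \<open>A\<close>. Since 0^0 = 1,
  mean 0 gives the point mass at 0, so the centred Gaussian is covered as well.\<close>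

definition pois :: "real \<Rightarrow> nat \<Rightarrow> real" where
  "pois A k = exp (- A) * A ^ k / fact k"

lemma pois_nonneg: "0 \<le> A \<Longrightarrow> 0 \<le> pois A k"
  by (simp add: pois_def)

text \<open>After exp(-(A + B)) / k! is taken out, the factorials form binomial coefficients and the
  binomial theorem applies.\<close>

lemma pois_convolution: "(\<Sum>j\<le>k. pois A j * pois B (k - j)) = pois (A + B) k"
proof -
  have "pois A j * pois B (k - j) = exp (- (A + B)) / fact k * (of_nat (k choose j) * A ^ j * B ^ (k - j))"
    if "j \<le> k" for j
    using that by (simp add: pois_def binomial_fact exp_add exp_diff exp_minus field_simps)
  then have "(\<Sum>j\<le>k. pois A j * pois B (k - j)) = exp (- (A + B)) / fact k * (A + B) ^ k"
    by (simp add: binomial_ring sum_distrib_left)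
  then show ?thesis by (simp add: pois_def)
qed

lemma suminf_swap_ennreal:
  fixes f :: "nat \<Rightarrow> nat \<Rightarrow> ennreal"
  shows "(\<Sum>i. \<Sum>j. f i j) = (\<Sum>j. \<Sum>i. f i j)"
proof -
  have "(\<Sum>i. \<Sum>j. f i j) = (\<integral>\<^sup>+i. (\<Sum>j. f i j) \<partial>count_space UNIV)"
    by (simp add: nn_integral_count_space_nat)
  also have "\<dots> = (\<Sum>j. \<integral>\<^sup>+i. f i j \<partial>count_space UNIV)"
    by (rule nn_integral_suminf) auto
  finally show ?thesis by (simp add: nn_integral_count_space_nat)
qed

text \<open>Regrouping along k = j + l: each inner sum is padded with zeros for k < j, after which
  it is an ordinary exchange of two nonnegative series.\<close>

lemma suminf_triangle_ennreal:
  fixes f :: "nat \<Rightarrow> nat \<Rightarrow> ennreal"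
  shows "(\<Sum>j. \<Sum>l. f j l) = (\<Sum>k. \<Sum>j\<le>k. f j (k - j))"
proof -
  have "(\<Sum>l. f j l) = (\<Sum>k. if j \<le> k then f j (k - j) else 0)" for j
    using suminf_offset[of "\<lambda>k. if j \<le> k then f j (k - j) else 0" j, OF summableI] by simp
  then have "(\<Sum>j. \<Sum>l. f j l) = (\<Sum>k. \<Sum>j. if j \<le> k then f j (k - j) else 0)"
    using suminf_swap_ennreal[of "\<lambda>j k. if j \<le> k then f j (k - j) else 0"] by simp
  moreover have "(\<Sum>j. if j \<le> k then f j (k - j) else 0) = (\<Sum>j\<le>k. f j (k - j))" for k
    by (subst suminf_finite[of "{..k}"]) auto
  ultimately show ?thesis by simp
qed

text \<open>\<open>F\<close> sees only j + l, so along each diagonal the weights add up to a Poisson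
  convolution.\<close>

lemma suminf_pois_convolution:
  fixes F :: "nat \<Rightarrow> ennreal"
  assumes "0 \<le> A" "0 \<le> B"
  shows "(\<Sum>j. ennreal (pois A j) * (\<Sum>l. ennreal (pois B l) * F (j + l))) = (\<Sum>k. ennreal (pois (A + B) k) * F k)"
proof -
  have "(\<Sum>j. ennreal (pois A j) * (\<Sum>l. ennreal (pois B l) * F (j + l)))
      = (\<Sum>j. \<Sum>l. ennreal (pois A j) * (ennreal (pois B l) * F (j + l)))"
    by simp
  also have "\<dots> = (\<Sum>k. \<Sum>j\<le>k. ennreal (pois A j) * (ennreal (pois B (k - j)) * F (j + (k - j))))"
    by (rule suminf_triangle_ennreal)
  also have "\<dots> = (\<Sum>k. (\<Sum>j\<le>k. ennreal (pois A j * pois B (k - j))) * F k)"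
    using assms by (simp add: sum_distrib_right ennreal_mult' pois_nonneg mult.assoc)
  also have "(\<lambda>k. \<Sum>j\<le>k. ennreal (pois A j * pois B (k - j))) = (\<lambda>k. ennreal (pois (A + B) k))"
    using assms by (subst sum_ennreal) (auto simp: pois_nonneg pois_convolution)
  finally show ?thesis .
qed

section \<open>The square of a shifted real Gaussian as a Poisson mixture\<close>

lemma cosh_sums_even: "(\<lambda>j. x ^ (2 * j) / fact (2 * j)) sums cosh (x::real)"
proof -
  have "(\<lambda>j. if even (2 * j) then x ^ (2 * j) /\<^sub>R fact (2 * j) else 0) sums cosh x"
    by (subst sums_mono_reindex[where g = "\<lambda>j. 2 * j"])
      (auto simp: strict_mono_def cosh_converges elim!: evenE)
  then show ?thesis by (simp add: divide_inverse mult.commute)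
qed

text \<open>The two preimages x and -x of x^2 contribute 2 exp(-x^2 - a^2) cosh(2ax) / sqrt(pi).
  Expanding cosh gives exactly the Poisson-weighted Gamma densities at x^2; the factor 2x is the
  Jacobian of squaring.\<close>

lemma gauss_kernel_fold:
  fixes a x :: real
  assumes "0 < x"
  shows "ennreal (exp (- (x - a)\<^sup>2) / sqrt pi) + ennreal (exp (- (- x - a)\<^sup>2) / sqrt pi) =
    ennreal (2 * x) * (\<Sum>j. ennreal (pois (a\<^sup>2) j * gamma_pdf (real j + 1 / 2) (x\<^sup>2)))"
proof -
  \<comment> \<open>The factor common to all terms of the series: sqrt(pi) comes from Gamma(j +
    1/2), and 1/x from (x^2)^(j - 1/2) = x^(2j) / x.\<close>
  define c where "c = exp (- x\<^sup>2 - a\<^sup>2) / (sqrt pi * x)"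
  have powr: "(x\<^sup>2) powr (real j + 1 / 2 - 1) = x ^ (2 * j) / x" for j
  proof -
    have "(x\<^sup>2) powr (real j + 1 / 2 - 1) = (x powr 2) powr (real j + 1 / 2 - 1)"
      using assms by simp
    also have "\<dots> = x powr (2 * (real j + 1 / 2 - 1))"
      by (rule powr_powr)
    also have "2 * (real j + 1 / 2 - 1) = real (2 * j) - 1"
      by simp
    also have "x powr (real (2 * j) - 1) = x ^ (2 * j) / x"
      using assms by (subst powr_diff, subst powr_realpow) auto
    finally show ?thesis .
  qed
  have "pois (a\<^sup>2) j * gamma_pdf (real j + 1 / 2) (x\<^sup>2) = c * ((2 * a * x) ^ (2 * j) / fact (2 * j))" for j
  proof -
    have "pois (a\<^sup>2) j * gamma_pdf (real j + 1 / 2) (x\<^sup>2) =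
        (exp (- a\<^sup>2) * exp (- x\<^sup>2)) * ((a\<^sup>2) ^ j * x ^ (2 * j) * 4 ^ j) / (sqrt pi * x * fact (2 * j))"
      using assms unfolding pois_def gamma_pdf_def Gamma_half_plus_nat powr by (simp add: mult_ac)
    also have "exp (- a\<^sup>2) * exp (- x\<^sup>2) = exp (- x\<^sup>2 - a\<^sup>2)"
      by (simp flip: exp_add)
    also have "(a\<^sup>2) ^ j * x ^ (2 * j) * 4 ^ j = (2 * a * x) ^ (2 * j)"
      by (simp add: power_mult_distrib power_mult)
    finally show ?thesis by (simp add: c_def)
  qed
  then have "(\<lambda>j. pois (a\<^sup>2) j * gamma_pdf (real j + 1 / 2) (x\<^sup>2)) sums (c * cosh (2 * a * x))"
    using sums_mult[OF cosh_sums_even[of "2 * a * x"], of c] by simp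
  then have "(\<Sum>j. ennreal (pois (a\<^sup>2) j * gamma_pdf (real j + 1 / 2) (x\<^sup>2))) = ennreal (c * cosh (2 * a * x))"
    by (intro suminf_ennreal_eq) (auto intro!: mult_nonneg_nonneg pois_nonneg gamma_pdf_nonneg)
  moreover have "exp (- (x - a)\<^sup>2) / sqrt pi + exp (- (- x - a)\<^sup>2) / sqrt pi = 2 * x * (c * cosh (2 * a * x))"
  proof -
    have *: "E * F / p + E * G / p = 2 * x * (E / (p * x) * ((F + G) / 2))" for E F G p :: real
      using assms by (cases "p = 0") (simp_all add: field_simps)
    have "- (x - a)\<^sup>2 = (- x\<^sup>2 - a\<^sup>2) + 2 * a * x" "- (- x - a)\<^sup>2 = (- x\<^sup>2 - a\<^sup>2) + - (2 * a * x)"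
      by (simp_all add: power2_eq_square algebra_simps)
    then have "exp (- (x - a)\<^sup>2) = exp (- x\<^sup>2 - a\<^sup>2) * exp (2 * a * x)"
      "exp (- (- x - a)\<^sup>2) = exp (- x\<^sup>2 - a\<^sup>2) * exp (- (2 * a * x))"
      by (simp_all only: exp_add)
    then show ?thesis by (simp only: c_def cosh_field_def *)
  qed
  moreover have "0 \<le> c * cosh (2 * a * x)"
    using assms by (simp add: c_def)
  ultimately show ?thesis using assms
    by (simp only: ennreal_plus[symmetric] ennreal_mult[symmetric] exp_ge_zero real_sqrt_ge_zero pi_ge_zero
      divide_nonneg_nonneg mult_nonneg_nonneg order_less_imp_le zero_le_numeral)
qed

text \<open>The kernel is the normal density of mean \<open>a\<close> and variance 1/2. Fold it at
  the origin, insert the series for the folded kernel, substitute u = x^2, and integrate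
  termwise.\<close>

lemma nn_integral_gauss_square:
  fixes g :: "real \<Rightarrow> ennreal"
  assumes [measurable]: "g \<in> borel_measurable borel"
  shows "(\<integral>\<^sup>+x. ennreal (exp (- (x - a)\<^sup>2) / sqrt pi) * g (x\<^sup>2) \<partial>lborel) =
    (\<Sum>j. ennreal (pois (a\<^sup>2) j) * (\<integral>\<^sup>+u. ennreal (gamma_pdf (real j + 1 / 2) u) * g u \<partial>lborel))"
proof -
  let ?K = "\<lambda>u. (\<Sum>j. ennreal (pois (a\<^sup>2) j * gamma_pdf (real j + 1 / 2) u))"
  have "(\<integral>\<^sup>+x. ennreal (exp (- (x - a)\<^sup>2) / sqrt pi) * g (x\<^sup>2) \<partial>lborel) =
      (\<integral>\<^sup>+x. (ennreal (exp (- (x - a)\<^sup>2) / sqrt pi) + ennreal (exp (- (- x - a)\<^sup>2) / sqrt pi)) * g (x\<^sup>2) * indicator {0..} x \<partial>lborel)"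
    by (rule nn_integral_even_reflect) auto
  also have "\<dots> = (\<integral>\<^sup>+x. ennreal (2 * x) * (?K (x\<^sup>2) * g (x\<^sup>2)) * indicator {0..} x \<partial>lborel)"
  proof (intro nn_integral_cong_AE)
    show "AE x in lborel. (ennreal (exp (- (x - a)\<^sup>2) / sqrt pi) + ennreal (exp (- (- x - a)\<^sup>2) / sqrt pi)) * g (x\<^sup>2) * indicator {0..} x
        = ennreal (2 * x) * (?K (x\<^sup>2) * g (x\<^sup>2)) * indicator {0..} x"
      using AE_lborel_singleton[of 0]
    proof eventually_elim
      case (elim x)
      show ?case
      proof (cases "0 < x")
        case True
        show ?thesis by (simp only: gauss_kernel_fold[OF True] mult.assoc)
      next
        case False
        then have "indicator {0..} x = (0 :: ennreal)" using elim by simp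
        then show ?thesis by (simp only: mult_zero_right)
      qed
    qed
  qed
  also have "\<dots> = (\<integral>\<^sup>+u. ?K u * g u * indicator {0..} u \<partial>lborel)"
    by (rule nn_integral_substitution_square[symmetric]) auto
  also have "\<dots> = (\<integral>\<^sup>+u. (\<Sum>j. ennreal (pois (a\<^sup>2) j) * (ennreal (gamma_pdf (real j + 1 / 2) u) * g u)) \<partial>lborel)"
  proof (intro nn_integral_cong)
    fix u :: real
    show "?K u * g u * indicator {0..} u = (\<Sum>j. ennreal (pois (a\<^sup>2) j) * (ennreal (gamma_pdf (real j + 1 / 2) u) * g u))"
    proof (cases "0 \<le> u")
      case True
      have "?K u * g u = (\<Sum>j. ennreal (pois (a\<^sup>2) j) * ennreal (gamma_pdf (real j + 1 / 2) u) * g u)"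
        by (simp only: ennreal_suminf_multc ennreal_mult' pois_nonneg zero_le_power2)
      then show ?thesis using True by (simp only: mult.assoc indicator_simps atLeast_iff mult_1_right)
    next
      case False
      then have "gamma_pdf \<alpha> u = 0" for \<alpha> by (simp add: gamma_pdf_def)
      then show ?thesis using False by (simp del: ennreal_suminf_cmult)
    qed
  qed
  also have "\<dots> = (\<Sum>j. \<integral>\<^sup>+u. ennreal (pois (a\<^sup>2) j) * (ennreal (gamma_pdf (real j + 1 / 2) u) * g u) \<partial>lborel)"
    by (rule nn_integral_suminf) auto
  also have "\<dots> = (\<Sum>j. ennreal (pois (a\<^sup>2) j) * (\<integral>\<^sup>+u. ennreal (gamma_pdf (real j + 1 / 2) u) * g u \<partial>lborel))"
    by (intro suminf_cong nn_integral_cmult) measurable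
  finally show ?thesis .
qed

section \<open>The squared modulus of a shifted complex Gaussian\<close>

text \<open>Since k! <= (k!)^2, the exponential series at (x/2)^2 dominates.\<close>

lemma bessel_I0_summable: "summable (\<lambda>k. (x / 2) ^ (2 * k) / (fact k)\<^sup>2 :: real)"
proof (rule summable_comparison_test'[where N = 0])
  show "summable (\<lambda>k. inverse (fact k) * ((x / 2)\<^sup>2) ^ k)"
    by (rule summable_exp)
  show "norm ((x / 2) ^ (2 * k) / (fact k)\<^sup>2) \<le> inverse (fact k) * ((x / 2)\<^sup>2) ^ k" for k
  proof -
    define y where "y = ((x / 2)\<^sup>2) ^ k"
    have y: "0 \<le> y" "(x / 2) ^ (2 * k) = y"
      unfolding y_def by (rule zero_le_power[OF zero_le_power2], rule power_mult)
    have "(fact k :: real) \<le> (fact k)\<^sup>2"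
      by (simp add: power2_eq_square)
    then have "y / (fact k)\<^sup>2 \<le> y / fact k"
      using y(1) by (intro divide_left_mono) auto
    then show ?thesis
      unfolding y(2) y_def[symmetric] using y(1) by (simp add: field_simps)
  qed
qed

lemma bessel_I0_nonneg: "0 \<le> bessel_I0 x"
  unfolding bessel_I0_def
  by (intro suminf_nonneg bessel_I0_summable divide_nonneg_nonneg zero_le_even_power) auto

lemma bessel_I0_0 [simp]: "bessel_I0 0 = 1"
proof -
  have "bessel_I0 0 = (\<Sum>k\<in>{0}. (0 / 2) ^ (2 * k) / (fact k)\<^sup>2)"
    unfolding bessel_I0_def by (rule suminf_finite) auto
  then show ?thesis by simp
qed

lemma bessel_I0_measurable [measurable]: "bessel_I0 \<in> borel_measurable borel"
  unfolding bessel_I0_def[abs_def] by measurable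

text \<open>The density of half a noncentral chi-square variable with two degrees of freedom and
  noncentrality 2A. It is meant for u >= 0 only: the formula does not vanish for u < 0, so integrals
  carry a separate indicator.\<close>

definition rice_pdf :: "real \<Rightarrow> real \<Rightarrow> real" where
  "rice_pdf A u = exp (- u - A) * bessel_I0 (2 * sqrt (A * u))"

lemma rice_pdf_measurable [measurable]: "rice_pdf A \<in> borel_measurable borel"
  unfolding rice_pdf_def by measurable

text \<open>One k! comes from the Poisson weight and one from Gamma(k + 1), and (A u)^k is the
  (2k)-th power of half the argument of the Bessel function.\<close>

lemma suminf_pois_gamma_pdf:
  assumes "0 \<le> A" "0 < u"
  shows "(\<Sum>k. ennreal (pois A k) * ennreal (gamma_pdf (real k + 1) u)) = ennreal (rice_pdf A u)"
proof -
  have "pois A k * gamma_pdf (real k + 1) u = exp (- u - A) * ((2 * sqrt (A * u) / 2) ^ (2 * k) / (fact k)\<^sup>2)" for k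
  proof -
    have "Gamma (real k + 1) = fact k"
      using Gamma_fact[of k, where 'a = real] by (simp add: add.commute)
    moreover have "u powr (real k + 1 - 1) = u ^ k"
      using assms by (simp add: powr_realpow)
    ultimately have "pois A k * gamma_pdf (real k + 1) u = (exp (- A) * exp (- u)) * ((A * u) ^ k / (fact k)\<^sup>2)"
      using assms unfolding pois_def gamma_pdf_def by (simp add: power_mult_distrib power2_eq_square)
    also have "exp (- A) * exp (- u) = exp (- u - A)"
      by (subst exp_add[symmetric]) simp
    also have "(A * u) ^ k = (2 * sqrt (A * u) / 2) ^ (2 * k)"
    proof -
      have "(2 * sqrt (A * u) / 2) ^ (2 * k) = ((sqrt (A * u))\<^sup>2) ^ k"
        by (simp only: power_mult nonzero_mult_div_cancel_left zero_neq_numeral[symmetric] not_False_eq_True)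
      also have "(sqrt (A * u))\<^sup>2 = A * u"
        using assms by (intro real_sqrt_pow2) simp
      finally show ?thesis ..
    qed
    finally show ?thesis .
  qed
  then have "(\<lambda>k. pois A k * gamma_pdf (real k + 1) u) sums rice_pdf A u"
    using sums_mult[OF summable_sums[OF bessel_I0_summable[of "2 * sqrt (A * u)"]], of "exp (- u - A)"]
    by (simp only: rice_pdf_def bessel_I0_def)
  then have "(\<Sum>k. ennreal (pois A k * gamma_pdf (real k + 1) u)) = ennreal (rice_pdf A u)"
    using assms by (intro suminf_ennreal_eq) (auto intro!: mult_nonneg_nonneg pois_nonneg gamma_pdf_nonneg)
  then show ?thesis using assms by (simp only: ennreal_mult' pois_nonneg)
qed

text \<open>Apply the one-dimensional mixture once in y and once in x. The Gamma shapes j + 1/2 and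
  l + 1/2 add up to j + l + 1, and the Poisson means add up to a^2 + b^2, so only the squared length
  of the shift survives.\<close>

lemma nn_integral_gauss_sum_squares:
  fixes g :: "real \<Rightarrow> ennreal"
  assumes [measurable]: "g \<in> borel_measurable borel"
  shows "(\<integral>\<^sup>+x. ennreal (exp (- (x - a)\<^sup>2) / sqrt pi) * (\<integral>\<^sup>+y. ennreal (exp (- (y - b)\<^sup>2) / sqrt pi) * g (x\<^sup>2 + y\<^sup>2) \<partial>lborel) \<partial>lborel)
    = (\<integral>\<^sup>+u. ennreal (rice_pdf (a\<^sup>2 + b\<^sup>2) u) * g u * indicator {0..} u \<partial>lborel)"
proof -
  let ?G = "\<lambda>\<alpha> u. ennreal (gamma_pdf \<alpha> u)"
  let ?F = "\<lambda>k. \<integral>\<^sup>+w. ?G (real k + 1) w * g w \<partial>lborel"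
  \<comment> \<open>The inner integral over y depends on x only through x^2; as a function
    \<open>H\<close> of x^2 it can be fed to the same lemma again.\<close>
  define H where "H u = (\<Sum>l. ennreal (pois (b\<^sup>2) l) * (\<integral>\<^sup>+v. ?G (real l + 1 / 2) v * g (u + v) \<partial>lborel))" for u
  have [measurable]: "H \<in> borel_measurable borel"
    unfolding H_def by measurable
  have "(\<integral>\<^sup>+y. ennreal (exp (- (y - b)\<^sup>2) / sqrt pi) * g (x\<^sup>2 + y\<^sup>2) \<partial>lborel) = H (x\<^sup>2)" for x
    unfolding H_def by (rule nn_integral_gauss_square) measurable
  then have "(\<integral>\<^sup>+x. ennreal (exp (- (x - a)\<^sup>2) / sqrt pi) * (\<integral>\<^sup>+y. ennreal (exp (- (y - b)\<^sup>2) / sqrt pi) * g (x\<^sup>2 + y\<^sup>2) \<partial>lborel) \<partial>lborel)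
      = (\<integral>\<^sup>+x. ennreal (exp (- (x - a)\<^sup>2) / sqrt pi) * H (x\<^sup>2) \<partial>lborel)"
    by simp
  also have "\<dots> = (\<Sum>j. ennreal (pois (a\<^sup>2) j) * (\<integral>\<^sup>+u. ?G (real j + 1 / 2) u * H u \<partial>lborel))"
    by (rule nn_integral_gauss_square) measurable
  also have "\<dots> = (\<Sum>j. ennreal (pois (a\<^sup>2) j) * (\<Sum>l. ennreal (pois (b\<^sup>2) l) * ?F (j + l)))"
  proof -
    have "(\<integral>\<^sup>+u. ?G (real j + 1 / 2) u * H u \<partial>lborel) = (\<Sum>l. ennreal (pois (b\<^sup>2) l) * ?F (j + l))" for j
    proof -
      have "(\<integral>\<^sup>+u. ?G (real j + 1 / 2) u * H u \<partial>lborel) =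
          (\<integral>\<^sup>+u. (\<Sum>l. ennreal (pois (b\<^sup>2) l) * (?G (real j + 1 / 2) u * (\<integral>\<^sup>+v. ?G (real l + 1 / 2) v * g (u + v) \<partial>lborel))) \<partial>lborel)"
        unfolding H_def by (simp only: ennreal_suminf_cmult[symmetric] mult.left_commute)
      also have "\<dots> = (\<Sum>l. \<integral>\<^sup>+u. ennreal (pois (b\<^sup>2) l) * (?G (real j + 1 / 2) u * (\<integral>\<^sup>+v. ?G (real l + 1 / 2) v * g (u + v) \<partial>lborel)) \<partial>lborel)"
        by (rule nn_integral_suminf) measurable
      also have "\<dots> = (\<Sum>l. ennreal (pois (b\<^sup>2) l) * (\<integral>\<^sup>+u. ?G (real j + 1 / 2) u * (\<integral>\<^sup>+v. ?G (real l + 1 / 2) v * g (u + v) \<partial>lborel) \<partial>lborel))"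
        by (intro suminf_cong nn_integral_cmult) measurable
      also have "\<dots> = (\<Sum>l. ennreal (pois (b\<^sup>2) l) * ?F (j + l))"
      proof -
        have "real j + 1 / 2 + (real l + 1 / 2) = real (j + l) + 1" for l by simp
        moreover have "(\<integral>\<^sup>+u. ?G (real j + 1 / 2) u * (\<integral>\<^sup>+v. ?G (real l + 1 / 2) v * g (u + v) \<partial>lborel) \<partial>lborel)
            = (\<integral>\<^sup>+w. ?G (real j + 1 / 2 + (real l + 1 / 2)) w * g w \<partial>lborel)" for l
          by (rule nn_integral_gamma_pdf_convolution) (auto intro: add_nonneg_pos)
        ultimately show ?thesis by (simp only:)
      qed
      finally show ?thesis .
    qed
    then show ?thesis by simp
  qed
  also have "\<dots> = (\<Sum>k. ennreal (pois (a\<^sup>2 + b\<^sup>2) k) * ?F k)"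
    by (rule suminf_pois_convolution) auto
  also have "\<dots> = (\<Sum>k. \<integral>\<^sup>+w. ennreal (pois (a\<^sup>2 + b\<^sup>2) k) * (?G (real k + 1) w * g w) \<partial>lborel)"
    by (intro suminf_cong nn_integral_cmult[symmetric]) measurable
  also have "\<dots> = (\<integral>\<^sup>+w. (\<Sum>k. ennreal (pois (a\<^sup>2 + b\<^sup>2) k) * (?G (real k + 1) w * g w)) \<partial>lborel)"
    by (rule nn_integral_suminf[symmetric]) measurable
  also have "\<dots> = (\<integral>\<^sup>+u. ennreal (rice_pdf (a\<^sup>2 + b\<^sup>2) u) * g u * indicator {0..} u \<partial>lborel)"
  proof (intro nn_integral_cong_AE)
    show "AE u in lborel. (\<Sum>k. ennreal (pois (a\<^sup>2 + b\<^sup>2) k) * (?G (real k + 1) u * g u)) =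
        ennreal (rice_pdf (a\<^sup>2 + b\<^sup>2) u) * g u * indicator {0..} u"
      using AE_lborel_singleton[of 0]
    proof eventually_elim
      case (elim u)
      show ?case
      proof (cases "0 < u")
        case True
        have "(\<Sum>k. ennreal (pois (a\<^sup>2 + b\<^sup>2) k) * (?G (real k + 1) u * g u))
            = (\<Sum>k. ennreal (pois (a\<^sup>2 + b\<^sup>2) k) * ?G (real k + 1) u) * g u"
          by (simp only: ennreal_suminf_multc[symmetric] mult.assoc)
        then show ?thesis using True by (simp add: suminf_pois_gamma_pdf)
      next
        case False
        then show ?thesis using elim by (simp add: gamma_pdf_def)
      qed
    qed
  qed
  finally show ?thesis .
qed

section \<open>Total mass, and the Marcum function as a tail probability\<close>

lemma nn_integral_gauss: "(\<integral>\<^sup>+x. ennreal (exp (- (x - a)\<^sup>2) / sqrt pi) \<partial>lborel) = 1"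
proof -
  interpret prob_space "density lborel (normal_density a (sqrt (1 / 2)))"
    by (rule prob_space_normal_density) simp
  have "exp (- (x - a)\<^sup>2) / sqrt pi = normal_density a (sqrt (1 / 2)) x" for x
    by (simp add: normal_density_def)
  then show ?thesis
    using emeasure_space_1 by (simp add: emeasure_density)
qed

text \<open>Take g = 1 and a shift of squared length \<open>A\<close>; the left side is then a
  product of two Gaussian masses.\<close>

lemma nn_integral_rice_pdf:
  assumes "0 \<le> A"
  shows "(\<integral>\<^sup>+u. ennreal (rice_pdf A u) * indicator {0..} u \<partial>lborel) = 1"
  using nn_integral_gauss_sum_squares[of "\<lambda>_. 1" "sqrt A" 0] assms
  by (simp add: nn_integral_gauss nn_integral_gauss[of 0, simplified])

text \<open>The substitution u = x^2 / 2, carried out as the scaling u = v / 2 followed by v = x^2.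
  It sends 2 sqrt(A u) to sqrt(2A) x and u >= R to x >= sqrt(2R).\<close>

lemma nn_integral_rice_pdf_tail:
  assumes "0 \<le> A" "0 \<le> R"
  shows "(\<integral>\<^sup>+u. ennreal (rice_pdf A u) * indicator {R..} u \<partial>lborel) =
    (\<integral>\<^sup>+x. ennreal (indicator {sqrt (2 * R)..} x * (x * exp (- (x\<^sup>2 + (sqrt (2 * A))\<^sup>2) / 2) * bessel_I0 (sqrt (2 * A) * x))) \<partial>lborel)"
proof -
  define f where "f u = ennreal (rice_pdf A u) * indicator {R..} u" for u
  have [measurable]: "f \<in> borel_measurable borel" unfolding f_def by measurable
  have "(\<integral>\<^sup>+u. f u \<partial>lborel) = (\<integral>\<^sup>+u. f u * indicator {0..} u \<partial>lborel)"
    using assms by (intro nn_integral_cong) (auto simp: f_def indicator_def)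
  also have "\<dots> = ennreal (1 / 2) * (\<integral>\<^sup>+v. f (v / 2) * indicator {0..} v \<partial>lborel)"
    by (subst nn_integral_real_affine[where c = "1 / 2" and t = 0]) (auto simp: indicator_def)
  also have "(\<integral>\<^sup>+v. f (v / 2) * indicator {0..} v \<partial>lborel) = (\<integral>\<^sup>+x. ennreal (2 * x) * f (x\<^sup>2 / 2) * indicator {0..} x \<partial>lborel)"
    by (rule nn_integral_substitution_square) measurable
  also have "ennreal (1 / 2) * \<dots> = (\<integral>\<^sup>+x. ennreal (1 / 2) * (ennreal (2 * x) * f (x\<^sup>2 / 2) * indicator {0..} x) \<partial>lborel)"
    by (rule nn_integral_cmult[symmetric]) measurable
  also have "\<dots> = (\<integral>\<^sup>+x. ennreal (indicator {sqrt (2 * R)..} x * (x * exp (- (x\<^sup>2 + (sqrt (2 * A))\<^sup>2) / 2) * bessel_I0 (sqrt (2 * A) * x))) \<partial>lborel)"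
  proof (intro nn_integral_cong)
    fix x :: real
    show "ennreal (1 / 2) * (ennreal (2 * x) * f (x\<^sup>2 / 2) * indicator {0..} x) =
      ennreal (indicator {sqrt (2 * R)..} x * (x * exp (- (x\<^sup>2 + (sqrt (2 * A))\<^sup>2) / 2) * bessel_I0 (sqrt (2 * A) * x)))"
    proof (cases "sqrt (2 * R) \<le> x")
      case True
      then have x: "0 \<le> x" using assms by (meson order_trans real_sqrt_ge_zero mult_nonneg_nonneg zero_le_numeral)
      have "R \<le> x\<^sup>2 / 2" using True x real_sqrt_le_iff[of "2 * R" "x\<^sup>2"] by simp
      moreover have "2 * sqrt (A * (x\<^sup>2 / 2)) = sqrt (2 * A) * x"
      proof -
        have "sqrt (4 * (A * (x\<^sup>2 / 2))) = sqrt ((2 * A) * x\<^sup>2)" by simp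
        then show ?thesis using x by (simp only: real_sqrt_mult) simp
      qed
      moreover have "ennreal (1 / 2) * ennreal (2 * x) = ennreal x"
        using x ennreal_mult[of "1 / 2" "2 * x"] by (simp only: divide_nonneg_nonneg zero_le_one zero_le_numeral mult_nonneg_nonneg) simp
      moreover have "- (x\<^sup>2 / 2) - A = - (x\<^sup>2 + (sqrt (2 * A))\<^sup>2) / 2"
        using assms by simp
      ultimately show ?thesis using True x
        by (simp only: f_def rice_pdf_def indicator_simps atLeast_iff mult_1_right mult_1 mult.assoc[symmetric])
          (simp add: ennreal_mult' bessel_I0_nonneg mult.assoc)
    next
      case False
      have "\<not> R \<le> x\<^sup>2 / 2" if "0 \<le> x" using False that real_sqrt_le_iff[of "2 * R" "x\<^sup>2"] by simp
      then show ?thesis using False by (cases "0 \<le> x") (simp_all add: f_def)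
    qed
  qed
  finally show ?thesis unfolding f_def .
qed

text \<open>\<open>marcum_Q1\<close> is a Bochner integral; its integrand is nonnegative on the
  range of integration because x >= sqrt(2R) >= 0, which allows the passage to the nonnegative
  integral.\<close>

lemma marcum_Q1_eq_tail:
  assumes "0 \<le> A" "0 \<le> R"
  shows "marcum_Q1 (sqrt (2 * A)) (sqrt (2 * R)) = enn2real (\<integral>\<^sup>+u. ennreal (rice_pdf A u) * indicator {R..} u \<partial>lborel)"
proof -
  have "0 \<le> indicator {sqrt (2 * R)..} x * (x * exp (- (x\<^sup>2 + (sqrt (2 * A))\<^sup>2) / 2) * bessel_I0 (sqrt (2 * A) * x))" for x
  proof (cases "sqrt (2 * R) \<le> x")
    case True
    then have "0 \<le> x" using order_trans[of 0 "sqrt (2 * R)" x] assms by simp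
    then show ?thesis by (simp add: bessel_I0_nonneg)
  qed simp
  then show ?thesis
    unfolding marcum_Q1_def set_lebesgue_integral_def nn_integral_rice_pdf_tail[OF assms] real_scaleR_def
    by (intro integral_eq_nn_integral) auto
qed

text \<open>Split the total mass 1 at \<open>R\<close>. The bound in the second claim makes 1 - Q1
  nonnegative, so that \<open>ennreal\<close> does not truncate it.\<close>

lemma rice_cdf:
  assumes "0 \<le> A" "0 \<le> R"
  shows "(\<integral>\<^sup>+u. ennreal (rice_pdf A u) * indicator {0..<R} u \<partial>lborel) = ennreal (1 - marcum_Q1 (sqrt (2 * A)) (sqrt (2 * R)))"
    and "marcum_Q1 (sqrt (2 * A)) (sqrt (2 * R)) \<le> 1"
proof -
  let ?T = "\<integral>\<^sup>+u. ennreal (rice_pdf A u) * indicator {R..} u \<partial>lborel"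
  let ?L = "\<integral>\<^sup>+u. ennreal (rice_pdf A u) * indicator {0..<R} u \<partial>lborel"
  have "?L + ?T = (\<integral>\<^sup>+u. ennreal (rice_pdf A u) * indicator {0..<R} u + ennreal (rice_pdf A u) * indicator {R..} u \<partial>lborel)"
    by (rule nn_integral_add[symmetric]) auto
  also have "\<dots> = (\<integral>\<^sup>+u. ennreal (rice_pdf A u) * indicator {0..} u \<partial>lborel)"
    using assms by (intro nn_integral_cong) (auto simp: indicator_def)
  finally have sum: "?L + ?T = 1" using assms by (simp add: nn_integral_rice_pdf)
  have "?T \<le> ?L + ?T" by (rule add_increasing) auto
  then have T: "?T \<le> 1" using sum by simp
  then have fin: "?T < top" by (rule le_less_trans) simp
  show "marcum_Q1 (sqrt (2 * A)) (sqrt (2 * R)) \<le> 1"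
    using T unfolding marcum_Q1_eq_tail[OF assms] by (intro enn2real_leI) auto
  have "?L = 1 - ?T" using fin by (simp flip: sum)
  also have "\<dots> = 1 - ennreal (enn2real ?T)" using fin by simp
  also have "\<dots> = ennreal (1 - enn2real ?T)" using ennreal_minus[of "enn2real ?T" 1] by simp
  finally show "?L = ennreal (1 - marcum_Q1 (sqrt (2 * A)) (sqrt (2 * R)))"
    unfolding marcum_Q1_eq_tail[OF assms] .
qed

section \<open>Expectations of functions of independent variables\<close>

context prob_space
begin

text \<open>A component of variance \<sigma>^2 / 2, divided by \<sigma> and shifted by
  \<open>a\<close>, is normal with mean \<open>a\<close> and variance 1/2; the proof substitutes
  \<sigma> (x - a) for the value of \<open>X\<close>.\<close>

lemma nn_integral_normal_affine:
  fixes X :: "'a \<Rightarrow> real" and f :: "real \<Rightarrow> ennreal"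
  assumes X: "distributed M lborel X (normal_density 0 (sqrt (\<sigma>\<^sup>2 / 2)))" and "0 < \<sigma>"
    and [measurable]: "f \<in> borel_measurable borel"
  shows "(\<integral>\<^sup>+\<omega>. f (X \<omega> / \<sigma> + a) \<partial>M) = (\<integral>\<^sup>+x. ennreal (exp (- (x - a)\<^sup>2) / sqrt pi) * f x \<partial>lborel)"
proof -
  have "(\<integral>\<^sup>+\<omega>. f (X \<omega> / \<sigma> + a) \<partial>M) = (\<integral>\<^sup>+x. ennreal (normal_density 0 (sqrt (\<sigma>\<^sup>2 / 2)) x) * f (x / \<sigma> + a) \<partial>lborel)"
    by (rule distributed_nn_integral[OF X, symmetric]) measurable
  also have "\<dots> = ennreal \<sigma> * (\<integral>\<^sup>+x. ennreal (normal_density 0 (sqrt (\<sigma>\<^sup>2 / 2)) (- \<sigma> * a + \<sigma> * x)) * f ((- \<sigma> * a + \<sigma> * x) / \<sigma> + a) \<partial>lborel)"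
    using assms(2) by (subst nn_integral_real_affine[where c = \<sigma> and t = "- \<sigma> * a"]) auto
  also have "\<dots> = (\<integral>\<^sup>+x. ennreal \<sigma> * (ennreal (normal_density 0 (sqrt (\<sigma>\<^sup>2 / 2)) (- \<sigma> * a + \<sigma> * x)) * f ((- \<sigma> * a + \<sigma> * x) / \<sigma> + a)) \<partial>lborel)"
    by (rule nn_integral_cmult[symmetric]) measurable
  also have "\<dots> = (\<integral>\<^sup>+x. ennreal (exp (- (x - a)\<^sup>2) / sqrt pi) * f x \<partial>lborel)"
  proof (intro nn_integral_cong)
    fix x :: real
    have "(- \<sigma> * a + \<sigma> * x)\<^sup>2 = \<sigma>\<^sup>2 * (x - a)\<^sup>2"
      by (simp add: power2_eq_square algebra_simps)
    moreover have "sqrt (2 * pi * (sqrt (\<sigma>\<^sup>2 / 2))\<^sup>2) = \<sigma> * sqrt pi"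
      using assms(2) by (simp add: real_sqrt_mult)
    ultimately have "\<sigma> * normal_density 0 (sqrt (\<sigma>\<^sup>2 / 2)) (- \<sigma> * a + \<sigma> * x) = exp (- (x - a)\<^sup>2) / sqrt pi"
      using assms(2) by (simp add: normal_density_def)
    moreover have "(- \<sigma> * a + \<sigma> * x) / \<sigma> + a = x"
      using assms(2) by (simp add: field_simps)
    ultimately show "ennreal \<sigma> * (ennreal (normal_density 0 (sqrt (\<sigma>\<^sup>2 / 2)) (- \<sigma> * a + \<sigma> * x)) * f ((- \<sigma> * a + \<sigma> * x) / \<sigma> + a))
        = ennreal (exp (- (x - a)\<^sup>2) / sqrt pi) * f x"
      using assms(2) by (simp only: mult.assoc[symmetric] ennreal_mult[symmetric] less_imp_le normal_density_nonneg)
  qed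
  finally show ?thesis .
qed

lemma nn_integral_indep_var:
  assumes "indep_var S X T Y" and [measurable]: "case_prod F \<in> borel_measurable (S \<Otimes>\<^sub>M T)"
  shows "(\<integral>\<^sup>+\<omega>. F (X \<omega>) (Y \<omega>) \<partial>M) = (\<integral>\<^sup>+\<omega>. (\<integral>\<^sup>+\<omega>'. F (X \<omega>) (Y \<omega>') \<partial>M) \<partial>M)"
proof -
  have [measurable]: "X \<in> measurable M S" "Y \<in> measurable M T"
    and eq: "distr M S X \<Otimes>\<^sub>M distr M T Y = distr M (S \<Otimes>\<^sub>M T) (\<lambda>\<omega>. (X \<omega>, Y \<omega>))"
    using assms(1) by (auto simp: indep_var_distribution_eq)
  interpret Y: prob_space "distr M T Y" by (rule prob_space_distr) measurable
  have "(\<integral>\<^sup>+\<omega>. F (X \<omega>) (Y \<omega>) \<partial>M) = (\<integral>\<^sup>+p. case_prod F p \<partial>distr M (S \<Otimes>\<^sub>M T) (\<lambda>\<omega>. (X \<omega>, Y \<omega>)))"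
    by (subst nn_integral_distr) auto
  also have "\<dots> = (\<integral>\<^sup>+x. \<integral>\<^sup>+y. F x y \<partial>distr M T Y \<partial>distr M S X)"
    unfolding eq[symmetric] by (subst Y.nn_integral_fst[symmetric]) auto
  also have "\<dots> = (\<integral>\<^sup>+\<omega>. \<integral>\<^sup>+y. F (X \<omega>) y \<partial>distr M T Y \<partial>M)"
    by (rule nn_integral_distr) auto
  also have "\<dots> = (\<integral>\<^sup>+\<omega>. (\<integral>\<^sup>+\<omega>'. F (X \<omega>) (Y \<omega>') \<partial>M) \<partial>M)"
    by (intro nn_integral_cong nn_integral_distr) auto
  finally show ?thesis .
qed

text \<open>Conditioning on \<open>Z k\<close>: with its value frozen, the factors depend on
  distinct independent variables, so the expectation of their product is the product of
  expectations. The joint law is a product measure, and coordinate \<open>k\<close> is integrated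
  last.\<close>

lemma nn_integral_prod_common_var:
  fixes Z :: "'i \<Rightarrow> 'a \<Rightarrow> 'b" and F :: "'i \<Rightarrow> 'b \<Rightarrow> 'b \<Rightarrow> ennreal"
  assumes I: "finite I" "k \<notin> I"
    and indep: "indep_vars (\<lambda>_. N) Z (insert k I)"
    and [measurable]: "f \<in> borel_measurable N" "\<And>i. case_prod (F i) \<in> borel_measurable (N \<Otimes>\<^sub>M N)"
  shows "(\<integral>\<^sup>+\<omega>. f (Z k \<omega>) * (\<Prod>i\<in>I. F i (Z k \<omega>) (Z i \<omega>)) \<partial>M)
    = (\<integral>\<^sup>+\<omega>. f (Z k \<omega>) * (\<Prod>i\<in>I. \<integral>\<^sup>+\<omega>'. F i (Z k \<omega>) (Z i \<omega>') \<partial>M) \<partial>M)"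
proof -
  let ?J = "insert k I"
  have Zm [measurable]: "Z i \<in> measurable M N" if "i \<in> ?J" for i
    using indep that by (auto simp: indep_vars_def)
  have Zk [measurable]: "Z k \<in> measurable M N" by (rule Zm) simp
  \<comment> \<open>The product-measure locale wants a sigma-finite measure at every index; outside
    \<open>?J\<close> the law of \<open>Z k\<close> is a harmless default.\<close>
  define D where "D i = (if i \<in> ?J then distr M N (Z i) else distr M N (Z k))" for i
  have D: "prob_space (D i)" and sets_D [measurable_cong, simp]: "sets (D i) = sets N" for i
    by (auto simp: D_def intro!: prob_space_distr)
  interpret D: product_sigma_finite D
    unfolding product_sigma_finite_def using D by (auto dest: prob_space_imp_sigma_finite)
  interpret Dk: sigma_finite_measure "D k" by (rule D.sigma_finite_measures)
  define G where "G x = f (x k) * (\<Prod>i\<in>I. F i (x k) (x i))" for x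
  have [measurable]: "G \<in> borel_measurable (PiM ?J (\<lambda>_. N))"
    unfolding G_def using I(1)
    by (intro borel_measurable_times_ennreal borel_measurable_prod_ennreal measurable_compose[OF _ assms(4)]
       measurable_compose[OF measurable_Pair assms(5), simplified]) auto
  have sets_PiM: "sets (PiM A D) = sets (PiM A (\<lambda>_. N))" for A
    by (rule sets_PiM_cong) auto
  have "distr M (PiM ?J (\<lambda>_. N)) (\<lambda>\<omega>. \<lambda>i\<in>?J. Z i \<omega>) = PiM ?J (\<lambda>i. distr M N (Z i))"
    using indep_vars_iff_distr_eq_PiM'[of ?J Z "\<lambda>_. N"] indep Zm by auto
  also have "\<dots> = PiM ?J D"
    by (rule PiM_cong) (auto simp: D_def)
  finally have joint: "distr M (PiM ?J (\<lambda>_. N)) (\<lambda>\<omega>. \<lambda>i\<in>?J. Z i \<omega>) = PiM ?J D" .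
  have "(\<integral>\<^sup>+\<omega>. f (Z k \<omega>) * (\<Prod>i\<in>I. F i (Z k \<omega>) (Z i \<omega>)) \<partial>M) = (\<integral>\<^sup>+\<omega>. G (\<lambda>i\<in>?J. Z i \<omega>) \<partial>M)"
    by (simp add: G_def)
  also have "\<dots> = (\<integral>\<^sup>+x. G x \<partial>PiM ?J D)"
    unfolding joint[symmetric] by (rule nn_integral_distr[symmetric], rule measurable_restrict, erule Zm, measurable)
  also have "\<dots> = (\<integral>\<^sup>+y. (\<integral>\<^sup>+x. G (x(k := y)) \<partial>PiM I D) \<partial>D k)"
    using I by (intro D.product_nn_integral_insert_rev) (auto simp: measurable_cong_sets[OF sets_PiM refl])
  also have "\<dots> = (\<integral>\<^sup>+y. f y * (\<Prod>i\<in>I. \<integral>\<^sup>+z. F i y z \<partial>D i) \<partial>D k)"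
  proof (rule nn_integral_cong)
    fix y assume "y \<in> space (D k)"
    then have y: "y \<in> space N" by (simp add: sets_eq_imp_space_eq[OF sets_D])
    have Fy [measurable]: "F i y \<in> borel_measurable (D i)" for i
      using measurable_compose[OF measurable_Pair1'[OF y] assms(5)[of i]]
      by (simp add: measurable_cong_sets[OF sets_D refl])
    have "G (x(k := y)) = f y * (\<Prod>i\<in>I. F i y (x i))" for x
    proof -
      have "(\<Prod>i\<in>I. F i y ((x(k := y)) i)) = (\<Prod>i\<in>I. F i y (x i))"
        using I by (intro prod.cong) auto
      then show ?thesis by (simp only: G_def fun_upd_same)
    qed
    then have "(\<integral>\<^sup>+x. G (x(k := y)) \<partial>PiM I D) = (\<integral>\<^sup>+x. f y * (\<Prod>i\<in>I. F i y (x i)) \<partial>PiM I D)"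
      by simp
    also have "\<dots> = f y * (\<integral>\<^sup>+x. (\<Prod>i\<in>I. F i y (x i)) \<partial>PiM I D)"
      using I(1) by (intro nn_integral_cmult borel_measurable_prod_ennreal) measurable
    also have "(\<integral>\<^sup>+x. (\<Prod>i\<in>I. F i y (x i)) \<partial>PiM I D) = (\<Prod>i\<in>I. \<integral>\<^sup>+z. F i y z \<partial>D i)"
      using I(1) by (intro D.product_nn_integral_prod Fy)
    finally show "(\<integral>\<^sup>+x. G (x(k := y)) \<partial>PiM I D) = f y * (\<Prod>i\<in>I. \<integral>\<^sup>+z. F i y z \<partial>D i)" .
  qed
  also have "\<dots> = (\<integral>\<^sup>+\<omega>. f (Z k \<omega>) * (\<Prod>i\<in>I. \<integral>\<^sup>+z. F i (Z k \<omega>) z \<partial>D i) \<partial>M)"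
  proof -
    have "(\<lambda>y. \<integral>\<^sup>+z. F i y z \<partial>D i) \<in> borel_measurable N" for i
    proof -
      interpret sigma_finite_measure "D i" by (rule D.sigma_finite_measures)
      show ?thesis by measurable
    qed
    then have m: "(\<lambda>y. f y * (\<Prod>i\<in>I. \<integral>\<^sup>+z. F i y z \<partial>D i)) \<in> borel_measurable N"
      by (intro borel_measurable_times_ennreal borel_measurable_prod_ennreal assms(4))
    have "D k = distr M N (Z k)" by (simp add: D_def)
    then show ?thesis using m by (simp add: nn_integral_distr[OF Zk])
  qed
  also have "\<dots> = (\<integral>\<^sup>+\<omega>. f (Z k \<omega>) * (\<Prod>i\<in>I. \<integral>\<^sup>+\<omega>'. F i (Z k \<omega>) (Z i \<omega>') \<partial>M) \<partial>M)"
  proof (intro nn_integral_cong arg_cong2[where f = "(*)"] refl prod.cong)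
    fix \<omega> i assume "\<omega> \<in> space M" and i: "i \<in> I"
    then have y: "Z k \<omega> \<in> space N" by (intro measurable_space[OF Zk])
    have "F i (Z k \<omega>) \<in> borel_measurable N"
      using measurable_compose[OF measurable_Pair1'[OF y] assms(5)[of i]] by simp
    then show "(\<integral>\<^sup>+z. F i (Z k \<omega>) z \<partial>D i) = (\<integral>\<^sup>+\<omega>'. F i (Z k \<omega>) (Z i \<omega>') \<partial>M)"
      using i nn_integral_distr[OF Zm] by (simp add: D_def)
  qed
  finally show ?thesis .
qed

end

text \<open>Split into real and imaginary parts, which are independent normals after scaling, and
  apply the two-dimensional sum of squares with shift (Re w, Im w).\<close>

lemma (in prob_space) nn_integral_complex_gaussian:
  fixes Z :: "'a \<Rightarrow> complex" and g :: "real \<Rightarrow> ennreal"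
  assumes Z: "complex_gaussian M Z (\<sigma>\<^sup>2)" and \<sigma>: "0 < \<sigma>"
    and [measurable]: "g \<in> borel_measurable borel"
  shows "(\<integral>\<^sup>+\<omega>. g ((cmod (Z \<omega> / of_real \<sigma> + w))\<^sup>2) \<partial>M)
    = (\<integral>\<^sup>+u. ennreal (rice_pdf ((cmod w)\<^sup>2) u) * g u * indicator {0..} u \<partial>lborel)"
proof -
  have re: "distributed M lborel (\<lambda>\<omega>. Re (Z \<omega>)) (normal_density 0 (sqrt (\<sigma>\<^sup>2 / 2)))"
    and im: "distributed M lborel (\<lambda>\<omega>. Im (Z \<omega>)) (normal_density 0 (sqrt (\<sigma>\<^sup>2 / 2)))"
    and indep: "indep_var borel (\<lambda>\<omega>. Re (Z \<omega>)) borel (\<lambda>\<omega>. Im (Z \<omega>))"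
    using Z by (auto simp: complex_gaussian_def)
  define K where "K x = (\<integral>\<^sup>+y. ennreal (exp (- (y - Im w)\<^sup>2) / sqrt pi) * g (x\<^sup>2 + y\<^sup>2) \<partial>lborel)" for x
  have [measurable]: "K \<in> borel_measurable borel"
    unfolding K_def by measurable
  have "(\<integral>\<^sup>+\<omega>. g ((cmod (Z \<omega> / of_real \<sigma> + w))\<^sup>2) \<partial>M)
      = (\<integral>\<^sup>+\<omega>. g ((Re (Z \<omega>) / \<sigma> + Re w)\<^sup>2 + (Im (Z \<omega>) / \<sigma> + Im w)\<^sup>2) \<partial>M)"
    by (simp only: cmod_power2 plus_complex.sel Re_divide_of_real Im_divide_of_real)
  also have "\<dots> = (\<integral>\<^sup>+\<omega>. (\<integral>\<^sup>+\<omega>'. g ((Re (Z \<omega>) / \<sigma> + Re w)\<^sup>2 + (Im (Z \<omega>') / \<sigma> + Im w)\<^sup>2) \<partial>M) \<partial>M)"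
    by (rule nn_integral_indep_var[OF indep]) measurable
  also have "\<dots> = (\<integral>\<^sup>+\<omega>. K (Re (Z \<omega>) / \<sigma> + Re w) \<partial>M)"
    unfolding K_def by (intro nn_integral_cong nn_integral_normal_affine[OF im \<sigma>]) measurable
  also have "\<dots> = (\<integral>\<^sup>+x. ennreal (exp (- (x - Re w)\<^sup>2) / sqrt pi) * K x \<partial>lborel)"
    by (rule nn_integral_normal_affine[OF re \<sigma>]) measurable
  also have "\<dots> = (\<integral>\<^sup>+u. ennreal (rice_pdf ((cmod w)\<^sup>2) u) * g u * indicator {0..} u \<partial>lborel)"
    unfolding K_def cmod_power2 by (rule nn_integral_gauss_sum_squares) measurable
  finally show ?thesis .
qed

lemma (in prob_space) complex_gaussian_disc:
  assumes "complex_gaussian M Z (\<sigma>\<^sup>2)" "0 < \<sigma>" "0 \<le> R"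
  shows "(\<integral>\<^sup>+\<omega>. indicator {0..<R} ((cmod (Z \<omega> / of_real \<sigma> + w))\<^sup>2) \<partial>M)
    = ennreal (1 - marcum_Q1 (sqrt (2 * (cmod w)\<^sup>2)) (sqrt (2 * R)))"
proof -
  have "(\<integral>\<^sup>+\<omega>. indicator {0..<R} ((cmod (Z \<omega> / of_real \<sigma> + w))\<^sup>2) \<partial>M)
      = (\<integral>\<^sup>+u. ennreal (rice_pdf ((cmod w)\<^sup>2) u) * indicator {0..<R} u * indicator {0..} u \<partial>lborel)"
    by (rule nn_integral_complex_gaussian[OF assms(1,2)]) measurable
  also have "\<dots> = (\<integral>\<^sup>+u. ennreal (rice_pdf ((cmod w)\<^sup>2) u) * indicator {0..<R} u \<partial>lborel)"
    by (intro nn_integral_cong) (auto simp: indicator_def)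
  also have "\<dots> = ennreal (1 - marcum_Q1 (sqrt (2 * (cmod w)\<^sup>2)) (sqrt (2 * R)))"
    using assms(3) by (intro rice_cdf) auto
  finally show ?thesis .
qed

section \<open>The port grid and the outage probability\<close>

lemma marcum_Q1_measurable [measurable]: "(\<lambda>a. marcum_Q1 a b) \<in> borel_measurable borel"
  unfolding marcum_Q1_def set_lebesgue_integral_def by measurable

text \<open>Without its corner the grid is the disjoint union of the rest of the first column, the
  rest of the first row, and the interior. One factor function \<open>q\<close> of the correlation
  coefficient serves all three.\<close>

lemma prod_grid_except_corner:
  fixes q :: "real \<Rightarrow> 'b :: comm_monoid_mult" and m n :: nat
  assumes "1 \<le> m" "1 \<le> n"
  shows "(\<Prod>p\<in>{1..m} \<times> {1..n} - {(1, 1)}. q ((if fst p = 1 then 1 else a) * (if snd p = 1 then 1 else b)))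
    = (\<Prod>i = 2..m. q a) * (\<Prod>j = 2..n. q b) * (\<Prod>i = 2..m. \<Prod>j = 2..n. q (a * b))"
proof -
  let ?f = "\<lambda>p. q ((if fst p = 1 then 1 else a) * (if snd p = 1 then 1 else b))"
  let ?A = "{2..m} \<times> {1::nat}" and ?B = "{1::nat} \<times> {2..n}" and ?C = "{2..m} \<times> {2..n}"
  have "{1..m} \<times> {1..n} - {(1, 1)} = (?A \<union> ?B) \<union> ?C"
    using assms by (auto simp: not_less_eq_eq numeral_2_eq_2)
  then have "prod ?f ({1..m} \<times> {1..n} - {(1, 1)}) = prod ?f ((?A \<union> ?B) \<union> ?C)"
    by simp
  also have "\<dots> = prod ?f ?A * prod ?f ?B * prod ?f ?C"
    by (subst prod.union_disjoint, simp, simp, force, subst prod.union_disjoint) auto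
  also have "prod ?f ?A = (\<Prod>i = 2..m. q a)"
    by (subst prod.cartesian_product') (auto intro!: prod.cong)
  also have "prod ?f ?B = (\<Prod>j = 2..n. q b)"
    by (subst prod.cartesian_product') (auto intro!: prod.cong)
  also have "prod ?f ?C = (\<Prod>i = 2..m. \<Prod>j = 2..n. q (a * b))"
    by (subst prod.cartesian_product') (auto intro!: prod.cong)
  finally show ?thesis .
qed

lemma fas_abs_square_less_iff:
  assumes "1 \<le> m" "1 \<le> n" "0 < \<sigma>"
  shows "(fas_abs m n h \<omega>)\<^sup>2 / \<sigma>\<^sup>2 < \<gamma> \<longleftrightarrow> (\<forall>p\<in>{1..m} \<times> {1..n}. (cmod (h (fst p) (snd p) \<omega> / of_real \<sigma>))\<^sup>2 < \<gamma>)"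
proof -
  let ?S = "(\<lambda>(i, j). cmod (h i j \<omega>)) ` ({1..m} \<times> {1..n})"
  have fin: "finite ?S" "?S \<noteq> {}" using assms by auto
  have "(cmod (h i j \<omega> / of_real \<sigma>))\<^sup>2 = (cmod (h i j \<omega>))\<^sup>2 / \<sigma>\<^sup>2" for i j
    by (simp add: norm_divide power_divide)
  moreover have "(Max ?S)\<^sup>2 / \<sigma>\<^sup>2 < \<gamma> \<longleftrightarrow> (\<forall>x\<in>?S. x\<^sup>2 / \<sigma>\<^sup>2 < \<gamma>)"
  proof
    assume *: "(Max ?S)\<^sup>2 / \<sigma>\<^sup>2 < \<gamma>"
    show "\<forall>x\<in>?S. x\<^sup>2 / \<sigma>\<^sup>2 < \<gamma>"
    proof
      fix x assume x: "x \<in> ?S"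
      then have "x\<^sup>2 \<le> (Max ?S)\<^sup>2" using fin by (intro power_mono Max_ge) auto
      then have "x\<^sup>2 / \<sigma>\<^sup>2 \<le> (Max ?S)\<^sup>2 / \<sigma>\<^sup>2" by (intro divide_right_mono) auto
      with * show "x\<^sup>2 / \<sigma>\<^sup>2 < \<gamma>" by linarith
    qed
  qed (use Max_in[OF fin] in blast)
  ultimately show ?thesis unfolding fas_abs_def by auto
qed

theorem theorem2:
  fixes M :: "'a measure"
    and MR MT :: nat
    and \<sigma> \<rho>1 \<rho>2 \<gamma> :: real
    and h z :: "nat \<Rightarrow> nat \<Rightarrow> 'a \<Rightarrow> complex"
  assumes "prob_space M"
    and "MR \<ge> 1" and "MT \<ge> 1"
    and "\<sigma> > 0" and "\<bar>\<rho>1\<bar> < 1" and "\<bar>\<rho>2\<bar> < 1" and "\<gamma> > 0"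
    and z_gaussian: "\<And>i j. i \<in> {1..MR} \<Longrightarrow> j \<in> {1..MT} \<Longrightarrow> complex_gaussian M (z i j) (\<sigma>\<^sup>2)"
    and z_indep: "prob_space.indep_vars M (\<lambda>_. borel) (\<lambda>(i, j). z i j) ({1..MR} \<times> {1..MT})"
    and h_11: "\<And>\<omega>. \<omega> \<in> space M \<Longrightarrow> h 1 1 \<omega> = z 1 1 \<omega>"
    and h_i1: "\<And>i \<omega>. i \<in> {2..MR} \<Longrightarrow> \<omega> \<in> space M \<Longrightarrow>
      h i 1 \<omega> = of_real (sqrt (1 - \<rho>1\<^sup>2)) * z i 1 \<omega> + of_real \<rho>1 * z 1 1 \<omega>"
    and h_1j: "\<And>j \<omega>. j \<in> {2..MT} \<Longrightarrow> \<omega> \<in> space M \<Longrightarrow>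
      h 1 j \<omega> = of_real (sqrt (1 - \<rho>2\<^sup>2)) * z 1 j \<omega> + of_real \<rho>2 * z 1 1 \<omega>"
    and h_ij: "\<And>i j \<omega>. i \<in> {2..MR} \<Longrightarrow> j \<in> {2..MT} \<Longrightarrow> \<omega> \<in> space M \<Longrightarrow>
      h i j \<omega> = of_real (sqrt (1 - \<rho>1\<^sup>2 * \<rho>2\<^sup>2)) * z i j \<omega> + of_real (\<rho>1 * \<rho>2) * z 1 1 \<omega>"
  shows "measure M {\<omega> \<in> space M. (fas_abs MR MT h \<omega>)\<^sup>2 / \<sigma>\<^sup>2 < \<gamma>} =
    (LBINT t:{0..\<gamma>}. exp (- t)
      * (\<Prod>i = 2..MR. 1 - marcum_Q1 (sqrt (2 * \<rho>1\<^sup>2 * t / (1 - \<rho>1\<^sup>2))) (sqrt (2 * \<gamma> / (1 - \<rho>1\<^sup>2))))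
      * (\<Prod>j = 2..MT. 1 - marcum_Q1 (sqrt (2 * \<rho>2\<^sup>2 * t / (1 - \<rho>2\<^sup>2))) (sqrt (2 * \<gamma> / (1 - \<rho>2\<^sup>2))))
      * (\<Prod>i = 2..MR. \<Prod>j = 2..MT. 1 - marcum_Q1
          (sqrt (2 * \<rho>2\<^sup>2 * \<rho>1\<^sup>2 * t / (1 - \<rho>1\<^sup>2 * \<rho>2\<^sup>2)))
          (sqrt (2 * \<gamma> / (1 - \<rho>1\<^sup>2 * \<rho>2\<^sup>2)))))"
proof -
  interpret prob_space M by fact
  \<comment> \<open>\<open>r p\<close> and \<open>c p\<close> are the coefficients of the common
    variable and of the port's own variable, uniformly in all cases. At the corner r = 1 and c = 0,
    so \<open>I\<close> leaves it out and division by \<open>c p\<close> is safe on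
    \<open>I\<close>.\<close>
  define r where "r p = (if fst p = 1 then 1 else \<rho>1) * (if snd p = 1 then 1 else \<rho>2)" for p :: "nat \<times> nat"
  define c where "c p = sqrt (1 - (r p)\<^sup>2)" for p
  define Z where "Z = (\<lambda>(i, j). z i j)"
  define I where "I = {1..MR} \<times> {1..MT} - {(1, 1)}"
  \<comment> \<open>The conditional probability that a port with coefficient x stays below
    threshold, given that the common variable has normalized squared modulus t.\<close>
  define q where "q t x = 1 - marcum_Q1 (sqrt (2 * (x\<^sup>2 / (1 - x\<^sup>2) * t))) (sqrt (2 * (\<gamma> / (1 - x\<^sup>2))))" for t x :: real
  define f where "f y = (indicator {0..<\<gamma>} ((cmod (y / of_real \<sigma>))\<^sup>2) :: ennreal)" for y
  \<comment> \<open>Dividing the port's gain condition by \<open>(c p)\<^sup>2\<close> leaves a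
    unit-scale Gaussian shifted by (r/c) times the common variable, with threshold
    \<open>\<gamma> / (c p)\<^sup>2\<close>.\<close>
  define F where "F p y x = (indicator {0..<\<gamma> / (c p)\<^sup>2}
      ((cmod (x / of_real \<sigma> + of_real (r p / c p) * (y / of_real \<sigma>)))\<^sup>2) :: ennreal)" for p y x
  define H where "H t = indicator {0..<\<gamma>} t * (\<Prod>p\<in>I. ennreal (q t (r p)))" for t
  let ?S = "{\<omega> \<in> space M. (fas_abs MR MT h \<omega>)\<^sup>2 / \<sigma>\<^sup>2 < \<gamma>}"

  have grid: "{1..MR} \<times> {1..MT} = insert (1, 1) I" and I: "finite I" "(1, 1) \<notin> I"
    using assms(2,3) by (auto simp: I_def)
  have Z_gauss: "complex_gaussian M (Z p) (\<sigma>\<^sup>2)" if "p \<in> insert (1, 1) I" for p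
    using that z_gaussian unfolding grid[symmetric] by (auto simp: Z_def)
  then have Z_meas: "Z p \<in> borel_measurable M" if "p \<in> insert (1, 1) I" for p
    using that by (simp add: complex_gaussian_def)
  have r_sq: "(r p)\<^sup>2 < 1" if "p \<in> I" for p
  proof -
    have "\<rho>1\<^sup>2 < 1" "\<rho>2\<^sup>2 < 1" using assms(5,6) by (simp_all add: abs_square_less_1)
    moreover have "\<rho>1\<^sup>2 * \<rho>2\<^sup>2 < 1" using calculation mult_le_cancel_left1[of "\<rho>1\<^sup>2" "\<rho>2\<^sup>2"]
      by (meson less_le_trans not_le zero_le_power2 le_less_trans mult_left_le less_imp_le)
    ultimately show ?thesis using that by (cases p) (auto simp: r_def I_def power_mult_distrib)
  qed
  then have c_sq: "(c p)\<^sup>2 = 1 - (r p)\<^sup>2" and c_pos: "0 < c p" if "p \<in> I" for p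
    using that by (simp_all add: c_def less_imp_le)
  have h_eq: "h (fst p) (snd p) \<omega> = of_real (c p) * Z p \<omega> + of_real (r p) * Z (1, 1) \<omega>"
    if "p \<in> I" "\<omega> \<in> space M" for p \<omega>
  proof -
    obtain i j where p: "p = (i, j)" by (cases p)
    have "1 \<le> i" "i \<le> MR" "1 \<le> j" "j \<le> MT" "i \<noteq> 1 \<or> j \<noteq> 1"
      using that(1) by (auto simp: I_def p)
    then consider "i \<in> {2..MR}" "j = 1" | "i = 1" "j \<in> {2..MT}" | "i \<in> {2..MR}" "j \<in> {2..MT}" by fastforce
    then show ?thesis
      using that(2) h_i1 h_1j h_ij
      by cases (auto simp: p r_def c_def Z_def power_mult_distrib)
  qed
  have scaled: "(cmod (h (fst p) (snd p) \<omega> / of_real \<sigma>))\<^sup>2 =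
      (c p)\<^sup>2 * (cmod (Z p \<omega> / of_real \<sigma> + of_real (r p / c p) * (Z (1, 1) \<omega> / of_real \<sigma>)))\<^sup>2"
    if "p \<in> I" "\<omega> \<in> space M" for p \<omega>
  proof -
    have "h (fst p) (snd p) \<omega> / of_real \<sigma> =
        of_real (c p) * (Z p \<omega> / of_real \<sigma> + of_real (r p / c p) * (Z (1, 1) \<omega> / of_real \<sigma>))"
      using c_pos[OF that(1)] assms(4) by (simp add: h_eq[OF that] field_simps)
    then show ?thesis by (simp only: norm_mult power_mult_distrib norm_of_real power2_abs)
  qed
  \<comment> \<open>The maximum is below threshold iff every port is, so the indicator factors over
    ports; apart from the common variable, each factor involves one variable of its own.\<close>
  have event: "indicator ?S \<omega> = f (Z (1, 1) \<omega>) * (\<Prod>p\<in>I. F p (Z (1, 1) \<omega>) (Z p \<omega>))"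
    if "\<omega> \<in> space M" for \<omega>
  proof -
    have "F p (Z (1, 1) \<omega>) (Z p \<omega>) = of_bool ((cmod (h (fst p) (snd p) \<omega> / of_real \<sigma>))\<^sup>2 < \<gamma>)"
      if "p \<in> I" for p
      using c_pos[OF that] unfolding scaled[OF that \<open>\<omega> \<in> space M\<close>]
      by (simp add: F_def indicator_def pos_less_divide_eq mult.commute)
    then have "(\<Prod>p\<in>I. F p (Z (1, 1) \<omega>) (Z p \<omega>)) = (\<Prod>p\<in>I. of_bool ((cmod (h (fst p) (snd p) \<omega> / of_real \<sigma>))\<^sup>2 < \<gamma>))"
      by (intro prod.cong) auto
    also have "\<dots> = of_bool (\<forall>p\<in>I. (cmod (h (fst p) (snd p) \<omega> / of_real \<sigma>))\<^sup>2 < \<gamma>)"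
      using I(1) by induction auto
    moreover have "f (Z (1, 1) \<omega>) = of_bool ((cmod (h 1 1 \<omega> / of_real \<sigma>))\<^sup>2 < \<gamma>)"
      using h_11[OF that] by (simp add: f_def indicator_def Z_def)
    moreover have "indicator ?S \<omega> = (of_bool (\<forall>p\<in>insert (1, 1) I. (cmod (h (fst p) (snd p) \<omega> / of_real \<sigma>))\<^sup>2 < \<gamma>) :: ennreal)"
      using that fas_abs_square_less_iff[OF assms(2,3,4), of h \<omega> \<gamma>] unfolding grid by (simp add: indicator_def)
    ultimately show ?thesis by simp
  qed

  have [measurable]: "f \<in> borel_measurable borel" "\<And>p. case_prod (F p) \<in> borel_measurable (borel \<Otimes>\<^sub>M borel)"
    unfolding f_def F_def by measurable
  have [measurable]: "(\<lambda>t. q t x) \<in> borel_measurable borel" for x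
    unfolding q_def by measurable
  have [measurable]: "H \<in> borel_measurable borel"
    unfolding H_def using I(1) by measurable
  \<comment> \<open>Nonnegativity lets the product of \<open>ennreal\<close> factors be read as
    \<open>ennreal\<close> of the real product.\<close>
  have q_nonneg: "0 \<le> q t (r p)" if "p \<in> I" "0 \<le> t" for p t
  proof -
    have "0 \<le> (r p)\<^sup>2 / (1 - (r p)\<^sup>2) * t" "0 \<le> \<gamma> / (1 - (r p)\<^sup>2)"
      using r_sq[OF that(1)] that(2) assms(7) by simp_all
    from rice_cdf(2)[OF this] show ?thesis by (simp add: q_def)
  qed

  have S: "?S \<in> sets M"
  proof -
    have [measurable]: "Z (1, 1) \<in> borel_measurable M" by (rule Z_meas) simp
    have fZ: "(\<lambda>\<omega>. f (Z (1, 1) \<omega>)) \<in> borel_measurable M" by measurable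
    have FZ: "(\<lambda>\<omega>. F p (Z (1, 1) \<omega>) (Z p \<omega>)) \<in> borel_measurable M" if "p \<in> I" for p
    proof -
      have [measurable]: "Z p \<in> borel_measurable M" using that by (intro Z_meas) simp
      show ?thesis by measurable
    qed
    have "(\<lambda>\<omega>. f (Z (1, 1) \<omega>) * (\<Prod>p\<in>I. F p (Z (1, 1) \<omega>) (Z p \<omega>))) \<in> borel_measurable M"
      by (intro borel_measurable_times_ennreal borel_measurable_prod_ennreal fZ FZ)
    then have "(indicator ?S :: _ \<Rightarrow> ennreal) \<in> borel_measurable M"
      by (subst measurable_cong[OF event])
    then show ?thesis by (simp add: borel_measurable_indicator_iff Int_absorb2 Collect_subset)
  qed
  have "emeasure M ?S = (\<integral>\<^sup>+\<omega>. f (Z (1, 1) \<omega>) * (\<Prod>p\<in>I. F p (Z (1, 1) \<omega>) (Z p \<omega>)) \<partial>M)"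
    using S by (simp add: event cong: nn_integral_cong flip: nn_integral_indicator)
  also have "\<dots> = (\<integral>\<^sup>+\<omega>. f (Z (1, 1) \<omega>) * (\<Prod>p\<in>I. \<integral>\<^sup>+\<omega>'. F p (Z (1, 1) \<omega>) (Z p \<omega>') \<partial>M) \<partial>M)"
    using z_indep unfolding grid Z_def[symmetric] by (intro nn_integral_prod_common_var I) measurable
  \<comment> \<open>The conditional factors depend on the common variable only through its squared
    modulus. The summand 0 fits the shifted Gaussian lemma with w = 0.\<close>
  also have "\<dots> = (\<integral>\<^sup>+\<omega>. H ((cmod (Z (1, 1) \<omega> / of_real \<sigma> + 0))\<^sup>2) \<partial>M)"
  proof (intro nn_integral_cong)
    fix \<omega>
    let ?v = "Z (1, 1) \<omega> / of_real \<sigma>"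
    have "(\<integral>\<^sup>+\<omega>'. F p (Z (1, 1) \<omega>) (Z p \<omega>') \<partial>M) = ennreal (q ((cmod ?v)\<^sup>2) (r p))" if p: "p \<in> I" for p
    proof -
      have "(cmod (of_real (r p / c p) * ?v))\<^sup>2 = (r p)\<^sup>2 / (1 - (r p)\<^sup>2) * (cmod ?v)\<^sup>2"
        by (simp only: norm_mult power_mult_distrib norm_of_real power2_abs power_divide c_sq[OF p])
      moreover have "0 \<le> \<gamma> / (1 - (r p)\<^sup>2)" using r_sq[OF p] assms(7) by simp
      ultimately show ?thesis
        using complex_gaussian_disc[OF Z_gauss[of p] assms(4), of "\<gamma> / (1 - (r p)\<^sup>2)" "of_real (r p / c p) * ?v"] p
        by (simp only: F_def q_def c_sq[OF p] insertI2)
    qed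
    then show "f (Z (1, 1) \<omega>) * (\<Prod>p\<in>I. \<integral>\<^sup>+\<omega>'. F p (Z (1, 1) \<omega>) (Z p \<omega>') \<partial>M) = H ((cmod (?v + 0))\<^sup>2)"
      by (simp add: H_def f_def)
  qed
  also have "\<dots> = (\<integral>\<^sup>+t. ennreal (rice_pdf ((cmod 0)\<^sup>2) t) * H t * indicator {0..} t \<partial>lborel)"
    by (rule nn_integral_complex_gaussian[OF Z_gauss assms(4)]) simp_all
  \<comment> \<open>With A = 0 the Bessel factor is 1 and the density becomes exp(-t). The strict
    threshold gives a half-open interval, which differs from the closed one in the null set
    {\<gamma>}.\<close>
  also have "\<dots> = (\<integral>\<^sup>+t. ennreal (indicator {0..\<gamma>} t * (exp (- t) * (\<Prod>p\<in>I. q t (r p)))) \<partial>lborel)"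
  proof (intro nn_integral_cong_AE)
    show "AE t in lborel. ennreal (rice_pdf ((cmod 0)\<^sup>2) t) * H t * indicator {0..} t =
        ennreal (indicator {0..\<gamma>} t * (exp (- t) * (\<Prod>p\<in>I. q t (r p))))"
      using AE_lborel_singleton[of \<gamma>]
    proof eventually_elim
      case (elim t)
      show ?case
      proof (cases "0 \<le> t \<and> t < \<gamma>")
        case True
        then have "(\<Prod>p\<in>I. ennreal (q t (r p))) = ennreal (\<Prod>p\<in>I. q t (r p))"
          by (intro prod_ennreal q_nonneg) auto
        then show ?thesis using True by (simp add: H_def rice_pdf_def ennreal_mult')
      next
        case False
        then show ?thesis using elim by (auto simp: H_def)
      qed
    qed
  qed
  finally have "measure M ?S = enn2real \<dots>"
    by (simp add: measure_def)
  also have "\<dots> = (LBINT t. indicator {0..\<gamma>} t * (exp (- t) * (\<Prod>p\<in>I. q t (r p))))"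
  proof (rule integral_eq_nn_integral[symmetric])
    show "AE t in lborel. 0 \<le> indicator {0..\<gamma>} t * (exp (- t) * (\<Prod>p\<in>I. q t (r p)))"
    proof (rule AE_I2)
      fix t
      have "0 \<le> (\<Prod>p\<in>I. q t (r p))" if "0 \<le> t"
        using q_nonneg that by (intro prod_nonneg) blast
      then show "0 \<le> indicator {0..\<gamma>} t * (exp (- t) * (\<Prod>p\<in>I. q t (r p)))"
        by (simp add: indicator_def)
    qed
  qed measurable
  also have "\<dots> = (LBINT t:{0..\<gamma>}. exp (- t) * (\<Prod>p\<in>I. q t (r p)))"
    by (simp add: set_lebesgue_integral_def)
  also have "(\<lambda>t. exp (- t) * (\<Prod>p\<in>I. q t (r p))) = (\<lambda>t. exp (- t) * (\<Prod>i = 2..MR. q t \<rho>1) * (\<Prod>j = 2..MT. q t \<rho>2)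
      * (\<Prod>i = 2..MR. \<Prod>j = 2..MT. q t (\<rho>1 * \<rho>2)))"
    unfolding I_def r_def prod_grid_except_corner[OF assms(2,3)] by (simp add: mult.assoc)
  finally show ?thesis
    by (simp only: q_def power_mult_distrib times_divide_eq_right times_divide_eq_left mult.assoc mult.commute[of "\<rho>2\<^sup>2" "\<rho>1\<^sup>2"]
      mult.left_commute[of "\<rho>2\<^sup>2" "\<rho>1\<^sup>2"])
qed

end
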